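(* Let $G$ be a non-Archimedean, non-discrete locally compact abelian group with Haar measure $\mu$. There exists a bounded open set $\Omega\subset G$ with $0<\mu(\Omega)<+\infty$ such that no subset $\Lambda\subset\widehat{G}$ forms a Riesz basis for $L^2(\Omega)$.
   Context: All groups are Polish (separable and completely metrizable). A locally compact abelian group is an abelian topological group whose topology is Hausdorff and in which every point has a compact neighborhood. A Polish group is non-Archimedean if it admits a compatible left-invariant ultrametric (equivalently, the identity has a neighborhood basis consisting of open subgroups). A subset of $G$ is bounded if it is contained in a compact subset of $G$. $\widehat{G}$ is the group of characters of $G$, i.e. continuous group homomorphisms $G\to\mathbb{T}=\{z\in\mathbb{C}:|z|=1\}$. $L^2(\Omega)$ is taken with respect to $\mu$ restricted to $\Omega$. A countable family $\{f_n\}$ in a separable Hilbert space $\mathcal{H}$ is a Riesz basis if $f_n=Te_n$ for all $n$, for some bounded invertible operator $T:\mathcal{H}\to\mathcal{H}$ and some orthonormal basis $\{e_n\}$ of $\mathcal{H}$; equivalently, $\{f_n\}$ is complete in $\mathcal{H}$ and there is $K>0$ with $\frac1K\sum_n|a_n|^2\le\|\sum_n a_nf_n\|^2\le K\sum_n|a_n|^2$ for all square-summable $\{a_n\}\subset\mathbb{C}$. A set $\Lambda\subset\widehat{G}$ forms a Riesz basis for $L^2(\Omega)$ if the family of restrictions to $\Omega$ of the characters in $\Lambda$ (indexed by $\Lambda$) is a Riesz basis of $L^2(\Omega)$. *)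

theory Defs
  imports "HOL-Analysis.Analysis"
begin

definition polish_top :: "'a topology \<Rightarrow> bool" where
  "polish_top X \<longleftrightarrow> separable_space X \<and> completely_metrizable_space X"

definition nonarchimedean_group_top :: "'a::group_add topology \<Rightarrow> bool" where
  "nonarchimedean_group_top X \<longleftrightarrow>
     (\<exists>d. Metric_space UNIV d \<and> Metric_space.mtopology UNIV d = X \<and>
          (\<forall>x y z. d x z \<le> max (d x y) (d y z)) \<and>
          (\<forall>a x y. d (a + x) (a + y) = d x y))"

text \<open>A Haar measure is a nonzero, translation-invariant Radon measure on the Borel sets.\<close>

definition haar_measure :: "'a::{topological_space, ab_group_add} measure \<Rightarrow> bool" where
  "haar_measure \<mu> \<longleftrightarrow>
     sets \<mu> = sets borel \<and>
     emeasure \<mu> UNIV \<noteq> 0 \<and>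
     (\<forall>a. \<forall>A\<in>sets borel. emeasure \<mu> ((\<lambda>x. a + x) ` A) = emeasure \<mu> A) \<and>
     (\<forall>K. compact K \<longrightarrow> emeasure \<mu> K < \<infinity>) \<and>
     (\<forall>A\<in>sets borel. emeasure \<mu> A = (INF U\<in>{U. open U \<and> A \<subseteq> U}. emeasure \<mu> U)) \<and>
     (\<forall>U. open U \<longrightarrow> emeasure \<mu> U = (SUP K\<in>{K. compact K \<and> K \<subseteq> U}. emeasure \<mu> K))"

definition characters :: "('a::{topological_space, ab_group_add} \<Rightarrow> complex) set" where
  "characters =
     {\<gamma>. continuous_on UNIV \<gamma> \<and> (\<forall>x. cmod (\<gamma> x) = 1) \<and> (\<forall>x y. \<gamma> (x + y) = \<gamma> x * \<gamma> y)}"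

text \<open>
  Elements of $L^2(M)$ are represented by square-integrable functions, and equality in $L^2(M)$
  is equality almost everywhere. Operators on $L^2(M)$ act on representatives and are
  required to respect this equality.
\<close>

definition L2 :: "'a measure \<Rightarrow> ('a \<Rightarrow> complex) set" where
  "L2 M = {f \<in> borel_measurable M. integrable M (\<lambda>x. (cmod (f x))\<^sup>2)}"

definition L2_eq :: "'a measure \<Rightarrow> ('a \<Rightarrow> complex) \<Rightarrow> ('a \<Rightarrow> complex) \<Rightarrow> bool" where
  "L2_eq M f g \<longleftrightarrow> (AE x in M. f x = g x)"

definition L2_inner :: "'a measure \<Rightarrow> ('a \<Rightarrow> complex) \<Rightarrow> ('a \<Rightarrow> complex) \<Rightarrow> complex" where
  "L2_inner M f g = (LINT x|M. f x * cnj (g x))"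

definition L2_norm :: "'a measure \<Rightarrow> ('a \<Rightarrow> complex) \<Rightarrow> real" where
  "L2_norm M f = sqrt (LINT x|M. (cmod (f x))\<^sup>2)"

definition L2_bounded_operator ::
  "'a measure \<Rightarrow> (('a \<Rightarrow> complex) \<Rightarrow> ('a \<Rightarrow> complex)) \<Rightarrow> bool" where
  "L2_bounded_operator M T \<longleftrightarrow>
     (\<forall>f\<in>L2 M. T f \<in> L2 M) \<and>
     (\<forall>f\<in>L2 M. \<forall>g\<in>L2 M. L2_eq M f g \<longrightarrow> L2_eq M (T f) (T g)) \<and>
     (\<forall>f\<in>L2 M. \<forall>g\<in>L2 M. L2_eq M (T (\<lambda>x. f x + g x)) (\<lambda>x. T f x + T g x)) \<and>
     (\<forall>c. \<forall>f\<in>L2 M. L2_eq M (T (\<lambda>x. c * f x)) (\<lambda>x. c * T f x)) \<and>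
     (\<exists>C. \<forall>f\<in>L2 M. L2_norm M (T f) \<le> C * L2_norm M f)"

definition L2_bounded_invertible_operator ::
  "'a measure \<Rightarrow> (('a \<Rightarrow> complex) \<Rightarrow> ('a \<Rightarrow> complex)) \<Rightarrow> bool" where
  "L2_bounded_invertible_operator M T \<longleftrightarrow>
     L2_bounded_operator M T \<and>
     (\<exists>S. L2_bounded_operator M S \<and>
          (\<forall>f\<in>L2 M. L2_eq M (S (T f)) f \<and> L2_eq M (T (S f)) f))"

definition L2_orthonormal_basis ::
  "'a measure \<Rightarrow> 'i set \<Rightarrow> ('i \<Rightarrow> 'a \<Rightarrow> complex) \<Rightarrow> bool" where
  "L2_orthonormal_basis M I e \<longleftrightarrow>
     (\<forall>i\<in>I. e i \<in> L2 M) \<and>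
     (\<forall>i\<in>I. \<forall>j\<in>I. L2_inner M (e i) (e j) = (if i = j then 1 else 0)) \<and>
     (\<forall>f\<in>L2 M. \<forall>\<epsilon>>0. \<exists>F c. finite F \<and> F \<subseteq> I \<and>
        L2_norm M (\<lambda>x. f x - (\<Sum>i\<in>F. c i * e i x)) < \<epsilon>)"

definition L2_riesz_basis ::
  "'a measure \<Rightarrow> 'i set \<Rightarrow> ('i \<Rightarrow> 'a \<Rightarrow> complex) \<Rightarrow> bool" where
  "L2_riesz_basis M I f \<longleftrightarrow>
     countable I \<and>
     (\<forall>i\<in>I. f i \<in> L2 M) \<and>
     (\<exists>T e. L2_bounded_invertible_operator M T \<and> L2_orthonormal_basis M I e \<and>
            (\<forall>i\<in>I. L2_eq M (f i) (T (e i))))"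

definition forms_riesz_basis ::
  "'a measure \<Rightarrow> 'a set \<Rightarrow> ('a \<Rightarrow> complex) set \<Rightarrow> bool" where
  "forms_riesz_basis \<mu> \<Omega> \<Lambda> \<longleftrightarrow>
     L2_riesz_basis (restrict_space \<mu> \<Omega>) \<Lambda> (\<lambda>\<gamma>. restrict \<gamma> \<Omega>)"

end

theory Submission
  imports Defs
begin

text \<open>
The group has compact open subgroups \<open>N 0 \<supseteq> N 1 \<supseteq> \<dots>\<close> for which the index of \<open>N (k + 1)\<close> in \<open>N k\<close>
tends to infinity. Choose \<open>x k\<close> in \<open>N k\<close> but not in \<open>N (k + 1)\<close>, and let \<open>\<Omega>\<close> be the union of the
cosets \<open>x k + N (k + 1)\<close>. Seen at the scale of \<open>N = N k\<close>, this set consists of some full cosets of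
\<open>N\<close> and, inside \<open>N\<close> itself, of a tiny portion: the coset \<open>x k + M\<close>, where \<open>M = N (k + 1)\<close>, and
something contained in \<open>M\<close>. A Riesz basis of characters cannot cope with such a portion, for the
following reason.

Let \<open>n\<close> be the index of \<open>M\<close> in \<open>N\<close>, and \<open>p > 0\<close> the number of full cosets of \<open>N\<close> in \<open>\<Omega>\<close>. Linear
independence allows at most \<open>p * n + 2\<close> members of the basis to be trivial on \<open>M\<close>. On the other hand
completeness, in the quantitative form of a lower bound \<open>\<alpha>\<close> for the sum of the squared coefficients
of a function of norm 1 (lemma \<open>riesz_basis_lower_bound\<close>), requires that they restrict to at least
\<open>n\<close> characters of \<open>N\<close>, each of which is the restriction of at least \<open>p\<close> basis elements. So all but
at most two of these characters have exactly \<open>p\<close> extensions in the basis, and exactly \<open>p\<close> extensions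
are completely used up by the \<open>p\<close> full cosets: whatever coefficients the indicator function of
\<open>x k + M\<close> has against them can be cancelled by a function on the full cosets. After these
cancellations only the extensions of at most two characters of \<open>N\<close>, no more than \<open>2 * p + 2\<close> basis
elements, still see the resulting function, whose norm is at least that of the indicator function.
This forces \<open>\<alpha> \<le> (2 * p + 2) * \<mu>(M)\<close> (lemma \<open>finite_frame_estimate\<close>), and comparing volumes gives
\<open>\<alpha> \<le> 2 * \<mu>(N 0) / n\<close> (lemma \<open>riesz_lower_bound_index_le\<close>). As \<open>n\<close> is unbounded along the chain,
no positive \<open>\<alpha>\<close> can exist.
\<close>

section \<open>Square-integrable functions and bounded operators\<close>

lemma measurable_cnj [measurable]: "cnj \<in> borel_measurable borel"
  by (intro borel_measurable_continuous_onI continuous_intros)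

lemma L2_square_integrable: "f \<in> L2 M \<Longrightarrow> integrable M (\<lambda>x. (cmod (f x))\<^sup>2)"
  by (simp add: L2_def)

lemma L2_add:
  assumes "f \<in> L2 M" "g \<in> L2 M"
  shows "(\<lambda>x. f x + g x) \<in> L2 M"
proof -
  have [measurable]: "f \<in> borel_measurable M" "g \<in> borel_measurable M"
    using assms by (auto simp: L2_def)
  have bound: "(cmod (a + b))\<^sup>2 \<le> 2 * ((cmod a)\<^sup>2 + (cmod b)\<^sup>2)" for a b :: complex
  proof -
    have "(cmod (a + b))\<^sup>2 \<le> (cmod a + cmod b)\<^sup>2"
      by (intro power_mono norm_triangle_ineq) auto
    also have "\<dots> \<le> 2 * ((cmod a)\<^sup>2 + (cmod b)\<^sup>2)"
      using zero_le_power2[of "cmod a - cmod b"] by (simp add: power2_eq_square algebra_simps)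
    finally show ?thesis .
  qed
  have "integrable M (\<lambda>x. 2 * ((cmod (f x))\<^sup>2 + (cmod (g x))\<^sup>2))"
    using assms by (auto simp: L2_def)
  then have "integrable M (\<lambda>x. (cmod (f x + g x))\<^sup>2)"
    by (rule Bochner_Integration.integrable_bound) (use bound in \<open>auto intro!: AE_I2\<close>)
  then show ?thesis by (simp add: L2_def)
qed

lemma L2_scale:
  assumes "f \<in> L2 M"
  shows "(\<lambda>x. c * f x) \<in> L2 M"
  using assms by (auto simp: L2_def norm_mult power_mult_distrib)

lemma L2_diff:
  assumes "f \<in> L2 M" "g \<in> L2 M"
  shows "(\<lambda>x. f x - g x) \<in> L2 M"
  using L2_add[OF assms(1) L2_scale[OF assms(2), of "-1"]] by simp

lemma L2_sum:
  assumes "\<And>i. i \<in> F \<Longrightarrow> f i \<in> L2 M"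
  shows "(\<lambda>x. \<Sum>i\<in>F. c i * f i x) \<in> L2 M"
  using assms
proof (induction F rule: infinite_finite_induct)
  case (insert i F)
  then show ?case
    using L2_add[OF L2_scale[of "f i" M "c i"], of "\<lambda>x. \<Sum>i\<in>F. c i * f i x"] by simp
qed (auto simp: L2_def)

lemma integrable_L2_inner:
  assumes "f \<in> L2 M" "g \<in> L2 M"
  shows "integrable M (\<lambda>x. f x * cnj (g x))"
proof -
  have [measurable]: "f \<in> borel_measurable M" "g \<in> borel_measurable M"
    using assms by (auto simp: L2_def)
  have bound: "a * b \<le> a\<^sup>2 + b\<^sup>2" for a b :: real
    using zero_le_power2[of "a - b"] zero_le_power2[of "a + b"]
    by (simp add: power2_eq_square algebra_simps)
  have "integrable M (\<lambda>x. (cmod (f x))\<^sup>2 + (cmod (g x))\<^sup>2)"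
    using assms by (auto simp: L2_def)
  then show ?thesis
    by (rule Bochner_Integration.integrable_bound)
       (use bound in \<open>auto intro!: AE_I2 simp: norm_mult\<close>)
qed

lemma L2_inner_add_left:
  assumes "f \<in> L2 M" "g \<in> L2 M" "h \<in> L2 M"
  shows "L2_inner M (\<lambda>x. f x + g x) h = L2_inner M f h + L2_inner M g h"
  unfolding L2_inner_def using assms
  by (simp add: distrib_right integrable_L2_inner)

lemma L2_inner_scale_left: "L2_inner M (\<lambda>x. c * f x) h = c * L2_inner M f h"
  unfolding L2_inner_def by (simp add: mult.assoc)

lemma L2_inner_cnj: "L2_inner M g f = cnj (L2_inner M f g)"
  using Bochner_Integration.integral_cnj[of M "\<lambda>x. f x * cnj (g x)"]
  unfolding L2_inner_def by (simp del: Bochner_Integration.integral_cnj add: mult.commute)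

lemma L2_inner_sum_left:
  assumes "\<And>i. i \<in> F \<Longrightarrow> f i \<in> L2 M" "h \<in> L2 M"
  shows "L2_inner M (\<lambda>x. \<Sum>i\<in>F. c i * f i x) h = (\<Sum>i\<in>F. c i * L2_inner M (f i) h)"
  using assms
proof (induction F rule: infinite_finite_induct)
  case (insert i F)
  have "L2_inner M (\<lambda>x. c i * f i x + (\<Sum>i\<in>F. c i * f i x)) h
      = L2_inner M (\<lambda>x. c i * f i x) h + L2_inner M (\<lambda>x. \<Sum>i\<in>F. c i * f i x) h"
    using insert.prems by (intro L2_inner_add_left L2_scale L2_sum) auto
  with insert show ?case by (simp add: L2_inner_scale_left)
qed (auto simp: L2_inner_def)

lemma L2_inner_sum_right:
  assumes "\<And>i. i \<in> F \<Longrightarrow> f i \<in> L2 M" "h \<in> L2 M"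
  shows "L2_inner M h (\<lambda>x. \<Sum>i\<in>F. c i * f i x) = (\<Sum>i\<in>F. cnj (c i) * L2_inner M h (f i))"
proof -
  have "L2_inner M h (\<lambda>x. \<Sum>i\<in>F. c i * f i x) = cnj (\<Sum>i\<in>F. c i * L2_inner M (f i) h)"
    using L2_inner_sum_left[of F f M h c] assms by (subst L2_inner_cnj) auto
  also have "\<dots> = (\<Sum>i\<in>F. cnj (c i) * L2_inner M h (f i))"
    by (simp add: L2_inner_cnj[of M h])
  finally show ?thesis .
qed

lemma L2_norm_nonneg: "0 \<le> L2_norm M f"
  by (simp add: L2_norm_def)

lemma L2_norm_square: "(L2_norm M f)\<^sup>2 = (LINT x|M. (cmod (f x))\<^sup>2)"
  by (simp add: L2_norm_def)

lemma L2_inner_self: "L2_inner M f f = of_real ((L2_norm M f)\<^sup>2)"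
  unfolding L2_inner_def L2_norm_square complex_norm_square[symmetric]
  by (simp flip: of_real_power)

lemma L2_norm_cong:
  assumes "L2_eq M f g" "f \<in> L2 M" "g \<in> L2 M"
  shows "L2_norm M f = L2_norm M g"
  unfolding L2_norm_def
proof (intro arg_cong[where f = sqrt] integral_cong_AE)
  show "AE x in M. (cmod (f x))\<^sup>2 = (cmod (g x))\<^sup>2"
    using assms(1) unfolding L2_eq_def by eventually_elim simp
qed (use assms in \<open>auto simp: L2_def\<close>)

text \<open>
The quadratic polynomial \<open>t \<mapsto> \<integral> (t |f| - |g|)\<^sup>2\<close> is nonnegative, so its discriminant is not positive.
\<close>

lemma L2_Cauchy_Schwarz:
  assumes "f \<in> L2 M" "g \<in> L2 M"
  shows "cmod (L2_inner M f g) \<le> L2_norm M f * L2_norm M g"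
proof -
  define A B C where "A = (LINT x|M. (cmod (f x))\<^sup>2)" and "B = (LINT x|M. (cmod (g x))\<^sup>2)"
    and "C = (LINT x|M. cmod (f x) * cmod (g x))"
  have int: "integrable M (\<lambda>x. cmod (f x) * cmod (g x))"
    using integrable_norm[OF integrable_L2_inner[OF assms]] by (simp add: norm_mult)
  have nonneg: "0 \<le> A" "0 \<le> B" "0 \<le> C" by (auto simp: A_def B_def C_def)
  have quad: "0 \<le> t\<^sup>2 * A - 2 * t * C + B" for t
  proof -
    have "0 \<le> (LINT x|M. (t * cmod (f x) - cmod (g x))\<^sup>2)" by simp
    also have "\<dots> = (LINT x|M. t\<^sup>2 * (cmod (f x))\<^sup>2 - 2 * t * (cmod (f x) * cmod (g x)) + (cmod (g x))\<^sup>2)"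
      by (simp add: power2_eq_square algebra_simps)
    also have "\<dots> = t\<^sup>2 * A - 2 * t * C + B"
      unfolding A_def B_def C_def using int assms[THEN L2_square_integrable] by simp
    finally show ?thesis .
  qed
  have "C\<^sup>2 \<le> A * B"
  proof (cases "A = 0")
    case True
    have "C = 0"
    proof (rule ccontr)
      assume "C \<noteq> 0"
      then show False using quad[of "(B + 1) / (2 * C)"] True by simp
    qed
    with True show ?thesis by simp
  next
    case False
    then show ?thesis
      using quad[of "C / A"] nonneg by (simp add: field_simps power2_eq_square)
  qed
  then have "C \<le> sqrt A * sqrt B"
    by (metis real_le_rsqrt real_sqrt_mult)
  moreover have "cmod (L2_inner M f g) \<le> C"
    using integral_norm_bound[of M "\<lambda>x. f x * cnj (g x)"]
    unfolding L2_inner_def C_def by (simp add: norm_mult)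
  ultimately show ?thesis
    by (simp add: L2_norm_def A_def B_def)
qed

lemma L2_norm_diff_triangle:
  assumes "f \<in> L2 M" "g \<in> L2 M"
  shows "L2_norm M g \<le> L2_norm M f + L2_norm M (\<lambda>x. f x - g x)"
proof -
  define r where "r = (\<lambda>x. g x - f x)"
  have r: "r \<in> L2 M" unfolding r_def using assms by (intro L2_diff)
  have "of_real ((L2_norm M g)\<^sup>2) = L2_inner M (\<lambda>x. f x + r x) g"
    by (simp add: r_def L2_inner_self)
  also have "\<dots> = L2_inner M f g + L2_inner M r g"
    using assms r by (intro L2_inner_add_left)
  finally have "(L2_norm M g)\<^sup>2 = cmod (L2_inner M f g + L2_inner M r g)"
    by (metis abs_of_nonneg norm_of_real zero_le_power2)
  also have "\<dots> \<le> L2_norm M f * L2_norm M g + L2_norm M r * L2_norm M g"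
    using L2_Cauchy_Schwarz[OF assms] L2_Cauchy_Schwarz[OF r assms(2)]
    by (intro norm_triangle_le add_mono)
  finally have "L2_norm M g * L2_norm M g \<le> (L2_norm M f + L2_norm M r) * L2_norm M g"
    by (simp add: power2_eq_square algebra_simps)
  moreover have "L2_norm M r = L2_norm M (\<lambda>x. f x - g x)"
    unfolding r_def L2_norm_def by (simp add: norm_minus_commute)
  ultimately show ?thesis
    using L2_norm_nonneg[of M g] L2_norm_nonneg[of M f] L2_norm_nonneg[of M r]
    by (smt (verit) mult_right_le_imp_le)
qed

section \<open>Two consequences of being a Riesz basis\<close>

lemma orthonormal_norm_sum:
  assumes "L2_orthonormal_basis M I e" "finite F" "F \<subseteq> I"
  shows "(L2_norm M (\<lambda>x. \<Sum>i\<in>F. c i * e i x))\<^sup>2 = (\<Sum>i\<in>F. (cmod (c i))\<^sup>2)"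
proof -
  have e: "\<And>i. i \<in> F \<Longrightarrow> e i \<in> L2 M"
    using assms unfolding L2_orthonormal_basis_def by auto
  have on: "L2_inner M (e i) (e j) = (if i = j then 1 else 0)" if "i \<in> F" "j \<in> F" for i j
    using assms that unfolding L2_orthonormal_basis_def by blast
  have "of_real ((L2_norm M (\<lambda>x. \<Sum>i\<in>F. c i * e i x))\<^sup>2)
      = (\<Sum>i\<in>F. c i * L2_inner M (e i) (\<lambda>x. \<Sum>j\<in>F. c j * e j x))"
    unfolding L2_inner_self[symmetric] using e by (intro L2_inner_sum_left L2_sum) auto
  also have "\<dots> = (\<Sum>i\<in>F. c i * (\<Sum>j\<in>F. cnj (c j) * (if i = j then 1 else 0)))"
    using e on by (intro sum.cong refl arg_cong2[where f = "(*)"]) (simp add: L2_inner_sum_right)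
  also have "\<dots> = (\<Sum>i\<in>F. c i * cnj (c i))"
    using assms(2) by (intro sum.cong refl) (simp add: if_distrib cong: if_cong)
  also have "\<dots> = of_real (\<Sum>i\<in>F. (cmod (c i))\<^sup>2)"
    by (simp only: complex_norm_square of_real_sum)
  finally show ?thesis using of_real_eq_iff by blast
qed

lemma L2_operatorD:
  assumes "L2_bounded_operator M T" "f \<in> L2 M"
  shows "T f \<in> L2 M"
    and "g \<in> L2 M \<Longrightarrow> L2_eq M f g \<Longrightarrow> L2_eq M (T f) (T g)"
    and "g \<in> L2 M \<Longrightarrow> L2_eq M (T (\<lambda>x. f x + g x)) (\<lambda>x. T f x + T g x)"
    and "L2_eq M (T (\<lambda>x. c * f x)) (\<lambda>x. c * T f x)"
  using assms unfolding L2_bounded_operator_def by simp_all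

lemma L2_operator_zero:
  assumes "L2_bounded_operator M T"
  shows "L2_eq M (T (\<lambda>x. 0)) (\<lambda>x. 0)"
  using L2_operatorD(4)[OF assms, of "\<lambda>x. 0" 0] by (simp add: L2_def)

lemma L2_operator_sum:
  assumes T: "L2_bounded_operator M T" and "finite F" and e: "\<And>i. i \<in> F \<Longrightarrow> e i \<in> L2 M"
  shows "L2_eq M (T (\<lambda>x. \<Sum>i\<in>F. c i * e i x)) (\<lambda>x. \<Sum>i\<in>F. c i * T (e i) x)"
  using assms(2,3)
proof (induction F rule: finite_induct)
  case empty
  show ?case using L2_operator_zero[OF T] by simp
next
  case (insert i F)
  have i: "e i \<in> L2 M" using insert.prems by simp
  have F: "(\<lambda>x. \<Sum>i\<in>F. c i * e i x) \<in> L2 M" using insert.prems by (intro L2_sum) auto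
  have "L2_eq M (T (\<lambda>x. c i * e i x + (\<Sum>i\<in>F. c i * e i x)))
          (\<lambda>x. T (\<lambda>x. c i * e i x) x + T (\<lambda>x. \<Sum>i\<in>F. c i * e i x) x)"
    by (rule L2_operatorD(3)[OF T L2_scale[OF i] F])
  moreover have "L2_eq M (T (\<lambda>x. c i * e i x)) (\<lambda>x. c i * T (e i) x)"
    by (rule L2_operatorD(4)[OF T i])
  moreover have "L2_eq M (T (\<lambda>x. \<Sum>i\<in>F. c i * e i x)) (\<lambda>x. \<Sum>i\<in>F. c i * T (e i) x)"
    using insert by auto
  ultimately have "L2_eq M (T (\<lambda>x. c i * e i x + (\<Sum>i\<in>F. c i * e i x)))
      (\<lambda>x. c i * T (e i) x + (\<Sum>i\<in>F. c i * T (e i) x))"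
    unfolding L2_eq_def by eventually_elim simp
  then show ?case using insert.hyps by simp
qed

text \<open>
Instead of passing to the adjoint of \<open>T\<close>, the proof tests \<open>h\<close> against combinations of the \<open>f i\<close>
that approximate \<open>h\<close> itself. Such combinations come from approximating \<open>S h\<close> in the orthonormal
basis, where \<open>S\<close> is the inverse of \<open>T\<close>; their coefficients are controlled by the norm of \<open>S\<close>, and the
Cauchy-Schwarz inequality for sums does the rest. The bound is stated with a finite set \<open>J\<close> because
it will be applied to functions that are orthogonal to all but finitely many members of the family.
\<close>

lemma riesz_basis_lower_bound:
  assumes "L2_riesz_basis M I f"
  obtains \<alpha> where "\<alpha> > 0"
    "\<And>h J. h \<in> L2 M \<Longrightarrow> finite J \<Longrightarrow> J \<subseteq> I \<Longrightarrow> (\<And>i. i \<in> I - J \<Longrightarrow> L2_inner M h (f i) = 0) \<Longrightarrow>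
       \<alpha> * (L2_norm M h)\<^sup>2 \<le> (\<Sum>i\<in>J. (cmod (L2_inner M h (f i)))\<^sup>2)"
proof -
  from assms obtain T S e where f: "\<And>i. i \<in> I \<Longrightarrow> f i \<in> L2 M"
    and T: "L2_bounded_operator M T" and S: "L2_bounded_operator M S"
    and TS: "\<And>h. h \<in> L2 M \<Longrightarrow> L2_eq M (T (S h)) h"
    and onb: "L2_orthonormal_basis M I e"
    and fTe: "\<And>i. i \<in> I \<Longrightarrow> L2_eq M (f i) (T (e i))"
    unfolding L2_riesz_basis_def L2_bounded_invertible_operator_def by blast
  have e: "\<And>i. i \<in> I \<Longrightarrow> e i \<in> L2 M" using onb unfolding L2_orthonormal_basis_def by blast
  obtain CT where CT: "\<And>h. h \<in> L2 M \<Longrightarrow> L2_norm M (T h) \<le> CT * L2_norm M h"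
    using T unfolding L2_bounded_operator_def by blast
  obtain CS where CS: "\<And>h. h \<in> L2 M \<Longrightarrow> L2_norm M (S h) \<le> CS * L2_norm M h"
    using S unfolding L2_bounded_operator_def by blast
  have TL: "T h \<in> L2 M" and SL: "S h \<in> L2 M" if "h \<in> L2 M" for h
    using L2_operatorD(1)[OF T that] L2_operatorD(1)[OF S that] by auto
  have key: "L2_norm M h \<le> CS * sqrt (\<Sum>i\<in>J. (cmod (L2_inner M h (f i)))\<^sup>2)"
    if h: "h \<in> L2 M" and J: "finite J" "J \<subseteq> I"
      and orth: "\<And>i. i \<in> I - J \<Longrightarrow> L2_inner M h (f i) = 0" and hpos: "L2_norm M h > 0" for h J
  proof -
    define R where "R = sqrt (\<Sum>i\<in>J. (cmod (L2_inner M h (f i)))\<^sup>2)"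
    define H where "H = L2_norm M h"
    have R0: "0 \<le> R" and R2: "R\<^sup>2 = (\<Sum>i\<in>J. (cmod (L2_inner M h (f i)))\<^sup>2)"
      by (simp_all add: R_def sum_nonneg)
    have eps: "H\<^sup>2 \<le> H * (\<bar>CT\<bar> * \<epsilon>) + (CS * H + \<epsilon>) * R" if "\<epsilon> > 0" for \<epsilon>
    proof -
      obtain F c where F: "finite F" "F \<subseteq> I"
        and approx: "L2_norm M (\<lambda>x. S h x - (\<Sum>i\<in>F. c i * e i x)) < \<epsilon>"
        using onb SL[OF h] \<open>\<epsilon> > 0\<close> unfolding L2_orthonormal_basis_def by meson
      define v w where "v = (\<lambda>x. \<Sum>i\<in>F. c i * e i x)" and "w = (\<lambda>x. \<Sum>i\<in>F. c i * f i x)"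
      have v: "v \<in> L2 M" unfolding v_def using F e by (intro L2_sum) auto
      have w: "w \<in> L2 M" unfolding w_def using F f by (intro L2_sum) auto
      have d: "(\<lambda>x. S h x + (-1) * v x) \<in> L2 M" using L2_diff[OF SL[OF h] v] by simp
      have "L2_eq M (T (\<lambda>x. S h x + (-1) * v x)) (\<lambda>x. T (S h) x + T (\<lambda>x. (-1) * v x) x)"
        by (rule L2_operatorD(3)[OF T SL[OF h] L2_scale[OF v]])
      moreover have "L2_eq M (T (\<lambda>x. (-1) * v x)) (\<lambda>x. (-1) * T v x)"
        by (rule L2_operatorD(4)[OF T v])
      moreover have "L2_eq M (T v) (\<lambda>x. \<Sum>i\<in>F. c i * T (e i) x)"
        unfolding v_def using F e by (intro L2_operator_sum[OF T]) auto
      moreover have "AE x in M. \<forall>i\<in>F. f i x = T (e i) x"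
        using fTe F unfolding L2_eq_def by (subst AE_finite_all) auto
      ultimately have "L2_eq M (T (\<lambda>x. S h x + (-1) * v x)) (\<lambda>x. h x - w x)"
        using TS[OF h] unfolding L2_eq_def w_def by eventually_elim simp
      then have "L2_norm M (\<lambda>x. h x - w x) = L2_norm M (T (\<lambda>x. S h x + (-1) * v x))"
        using L2_norm_cong[OF _ TL[OF d] L2_diff[OF h w]] by simp
      also have "\<dots> \<le> CT * L2_norm M (\<lambda>x. S h x + (-1) * v x)" using CT[OF d] .
      also have "\<dots> \<le> \<bar>CT\<bar> * \<epsilon>"
        using approx L2_norm_nonneg by (intro mult_mono) (auto simp: v_def)
      finally have hw: "L2_norm M (\<lambda>x. h x - w x) \<le> \<bar>CT\<bar> * \<epsilon>" .
      have "L2_norm M v \<le> L2_norm M (S h) + L2_norm M (\<lambda>x. S h x - v x)"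
        by (rule L2_norm_diff_triangle[OF SL[OF h] v])
      then have nv: "L2_norm M v \<le> CS * H + \<epsilon>"
        using CS[OF h] approx unfolding H_def v_def by linarith
      have "cmod (L2_inner M h w) = cmod (\<Sum>i\<in>F. cnj (c i) * L2_inner M h (f i))"
        unfolding w_def using F f h by (subst L2_inner_sum_right) auto
      also have "\<dots> = cmod (\<Sum>i\<in>F \<inter> J. cnj (c i) * L2_inner M h (f i))"
        using F orth by (intro arg_cong[where f = cmod] sum.mono_neutral_right) auto
      also have "\<dots> \<le> (\<Sum>i\<in>F \<inter> J. cmod (c i) * cmod (L2_inner M h (f i)))"
        by (rule order_trans[OF norm_sum]) (simp add: norm_mult)
      also have "\<dots> \<le> sqrt ((\<Sum>i\<in>F \<inter> J. (cmod (c i))\<^sup>2) * (\<Sum>i\<in>F \<inter> J. (cmod (L2_inner M h (f i)))\<^sup>2))"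
        by (intro real_le_rsqrt Cauchy_Schwarz_ineq_sum)
      also have "\<dots> \<le> sqrt ((L2_norm M v)\<^sup>2 * R\<^sup>2)"
        unfolding v_def R2 orthonormal_norm_sum[OF onb F]
        using F J by (intro real_sqrt_le_mono mult_mono) (auto intro!: sum_mono2 sum_nonneg)
      also have "\<dots> = L2_norm M v * R"
        using L2_norm_nonneg[of M v] R0 by (simp add: real_sqrt_mult)
      also have "\<dots> \<le> (CS * H + \<epsilon>) * R"
        by (rule mult_right_mono[OF nv R0])
      finally have hw2: "cmod (L2_inner M h w) \<le> (CS * H + \<epsilon>) * R" .
      have d': "(\<lambda>x. h x - w x) \<in> L2 M" by (rule L2_diff[OF h w])
      have "of_real (H\<^sup>2) = L2_inner M (\<lambda>x. (h x - w x) + w x) h"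
        by (simp add: H_def L2_inner_self)
      also have "\<dots> = L2_inner M (\<lambda>x. h x - w x) h + L2_inner M w h"
        by (rule L2_inner_add_left[OF d' w h])
      finally have "H\<^sup>2 = cmod (L2_inner M (\<lambda>x. h x - w x) h + L2_inner M w h)"
        by (metis abs_of_nonneg norm_of_real zero_le_power2)
      also have "\<dots> \<le> L2_norm M (\<lambda>x. h x - w x) * H + cmod (L2_inner M h w)"
        using L2_Cauchy_Schwarz[OF d' h] unfolding H_def
        by (intro norm_triangle_le add_mono) (auto simp: L2_inner_cnj[of M w h])
      also have "\<dots> \<le> (\<bar>CT\<bar> * \<epsilon>) * H + (CS * H + \<epsilon>) * R"
        using hw hw2 L2_norm_nonneg[of M h] unfolding H_def by (intro add_mono mult_right_mono)
      finally show ?thesis by (simp add: mult.commute)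
    qed
    \<comment> \<open>The approximation error disappears as \<open>\<epsilon>\<close> tends to zero.\<close>
    have "((\<lambda>\<epsilon>. H * (\<bar>CT\<bar> * \<epsilon>) + (CS * H + \<epsilon>) * R) \<longlongrightarrow> H * (\<bar>CT\<bar> * 0) + (CS * H + 0) * R) (at_right 0)"
      by (intro tendsto_intros)
    then have "H\<^sup>2 \<le> H * (\<bar>CT\<bar> * 0) + (CS * H + 0) * R"
      by (rule tendsto_lowerbound) (use eps in \<open>auto simp: eventually_at_right_less eventually_at_filter\<close>)
    then show ?thesis using hpos unfolding H_def R_def by (simp add: power2_eq_square)
  qed
  show ?thesis
  \<comment> \<open>The summand 1 keeps the constant meaningful when the norm bound \<open>CS\<close> is zero.\<close>
  proof (rule that[of "1 / (CS\<^sup>2 + 1)"])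
    show "1 / (CS\<^sup>2 + 1) > 0" by (simp add: add_nonneg_pos)
    fix h J assume asm: "h \<in> L2 M" "finite J" "J \<subseteq> I" "\<And>i. i \<in> I - J \<Longrightarrow> L2_inner M h (f i) = 0"
    define Q where "Q = (\<Sum>i\<in>J. (cmod (L2_inner M h (f i)))\<^sup>2)"
    have Q: "0 \<le> Q" by (simp add: Q_def sum_nonneg)
    have "(L2_norm M h)\<^sup>2 \<le> CS\<^sup>2 * Q"
    proof (cases "L2_norm M h > 0")
      case True
      have "L2_norm M h \<le> CS * sqrt Q" using key[OF asm True] by (simp add: Q_def)
      then have "(L2_norm M h)\<^sup>2 \<le> (CS * sqrt Q)\<^sup>2"
        using L2_norm_nonneg by (intro power_mono) auto
      then show ?thesis using Q by (simp add: power_mult_distrib)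
    next
      case False
      then show ?thesis using L2_norm_nonneg[of M h] Q by auto
    qed
    also have "\<dots> \<le> (CS\<^sup>2 + 1) * Q" using Q by (intro mult_right_mono) auto
    finally show "1 / (CS\<^sup>2 + 1) * (L2_norm M h)\<^sup>2 \<le> (\<Sum>i\<in>J. (cmod (L2_inner M h (f i)))\<^sup>2)"
      unfolding Q_def by (simp add: divide_le_eq add_nonneg_pos mult.commute)
  qed
qed

lemma riesz_basis_independent:
  assumes "L2_riesz_basis M I f" and F: "finite F" "F \<subseteq> I"
    and zero: "AE x in M. (\<Sum>i\<in>F. c i * f i x) = 0"
  shows "\<forall>i\<in>F. c i = 0"
proof -
  from assms(1) obtain T S e where T: "L2_bounded_operator M T" and S: "L2_bounded_operator M S"
    and ST: "\<And>h. h \<in> L2 M \<Longrightarrow> L2_eq M (S (T h)) h"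
    and onb: "L2_orthonormal_basis M I e"
    and fTe: "\<And>i. i \<in> I \<Longrightarrow> L2_eq M (f i) (T (e i))"
    unfolding L2_riesz_basis_def L2_bounded_invertible_operator_def by blast
  have e: "\<And>i. i \<in> F \<Longrightarrow> e i \<in> L2 M" using onb F unfolding L2_orthonormal_basis_def by blast
  define v where "v = (\<lambda>x. \<Sum>i\<in>F. c i * e i x)"
  have v: "v \<in> L2 M" unfolding v_def using e by (rule L2_sum)
  have z: "(\<lambda>x. 0) \<in> L2 M" by (simp add: L2_def)
  have Tv: "T v \<in> L2 M" by (rule L2_operatorD(1)[OF T v])
  have "L2_eq M (T v) (\<lambda>x. \<Sum>i\<in>F. c i * T (e i) x)"
    unfolding v_def using F e by (intro L2_operator_sum[OF T]) auto
  moreover have "AE x in M. \<forall>i\<in>F. f i x = T (e i) x"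
    using fTe F unfolding L2_eq_def by (subst AE_finite_all) auto
  ultimately have "L2_eq M (T v) (\<lambda>x. 0)"
    using zero unfolding L2_eq_def by eventually_elim simp
  then have "L2_eq M (S (T v)) (S (\<lambda>x. 0))"
    by (rule L2_operatorD(2)[OF S Tv z])
  moreover have "L2_eq M (S (\<lambda>x. 0)) (\<lambda>x. 0)"
    by (rule L2_operator_zero[OF S])
  ultimately have "L2_eq M v (\<lambda>x. 0)"
    using ST[OF v] unfolding L2_eq_def by eventually_elim simp
  then have "L2_norm M v = 0"
    using L2_norm_cong[OF _ v z] by (simp add: L2_norm_def)
  then have "(\<Sum>i\<in>F. (cmod (c i))\<^sup>2) = 0"
    using orthonormal_norm_sum[OF onb F, of c] by (simp add: v_def)
  then show ?thesis using F by (simp add: sum_nonneg_eq_0_iff)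
qed

section \<open>Linear systems indexed by finite sets\<close>

lemma underdetermined_system_nontrivial_solution:
  fixes m :: "'i \<Rightarrow> 'j \<Rightarrow> 'b::field"
  assumes "finite X" "finite Y" "card Y < card X"
  obtains c where "\<exists>x\<in>X. c x \<noteq> 0" "\<And>y. y \<in> Y \<Longrightarrow> (\<Sum>x\<in>X. c x * m x y) = 0"
proof -
  have "\<exists>c. (\<exists>x\<in>X. c x \<noteq> 0) \<and> (\<forall>y\<in>Y. (\<Sum>x\<in>X. c x * m x y) = 0)"
    using assms(2,1,3)
  proof (induction Y arbitrary: X m rule: finite_induct)
    case empty
    then have "X \<noteq> {}" by auto
    then show ?case by (intro exI[of _ "\<lambda>_. 1"]) auto
  next
    case (insert y0 Y)
    show ?case
    proof (cases "\<forall>x\<in>X. m x y0 = 0")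
      case True
      have "card Y < card X" using insert.hyps insert.prems by simp
      from insert.IH[OF insert.prems(1) this, of m] obtain c where
        "\<exists>x\<in>X. c x \<noteq> 0" "\<forall>y\<in>Y. (\<Sum>x\<in>X. c x * m x y) = 0" by blast
      with True show ?thesis by (intro exI[of _ c]) simp
    next
      case False
      then obtain x0 where x0: "x0 \<in> X" "m x0 y0 \<noteq> 0" by blast
      define X' where "X' = X - {x0}"
      have X': "finite X'" "x0 \<notin> X'" "X = insert x0 X'" using insert.prems x0 by (auto simp: X'_def)
      \<comment> \<open>Gaussian elimination of the unknown at \<open>x0\<close> by means of the equation \<open>y0\<close>.\<close>
      define m' where "m' x y = m x y - m x y0 / m x0 y0 * m x0 y" for x y
      have "card Y < card X'" using insert.hyps insert.prems X' by simp
      from insert.IH[OF X'(1) this, of m'] obtain c where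
        c: "\<exists>x\<in>X'. c x \<noteq> 0" "\<forall>y\<in>Y. (\<Sum>x\<in>X'. c x * m' x y) = 0" by blast
      define d where "d = c(x0 := - (\<Sum>x\<in>X'. c x * m x y0) / m x0 y0)"
      have sum_d: "(\<Sum>x\<in>X. d x * m x y) = (\<Sum>x\<in>X'. c x * m' x y)" for y
      proof -
        have "(\<Sum>x\<in>X. d x * m x y) = d x0 * m x0 y + (\<Sum>x\<in>X'. d x * m x y)"
          using X' by simp
        also have "(\<Sum>x\<in>X'. d x * m x y) = (\<Sum>x\<in>X'. c x * m x y)"
          using X' by (intro sum.cong) (auto simp: d_def)
        also have "d x0 * m x0 y = - (\<Sum>x\<in>X'. c x * (m x y0 / m x0 y0 * m x0 y))"
          by (simp add: d_def sum_distrib_right sum_divide_distrib mult.assoc)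
        also have "\<dots> + (\<Sum>x\<in>X'. c x * m x y) = (\<Sum>x\<in>X'. c x * m' x y)"
          by (simp add: m'_def right_diff_distrib sum_subtractf)
        finally show ?thesis .
      qed
      have "\<exists>x\<in>X. d x \<noteq> 0" using c(1) X' by (auto simp: d_def)
      moreover have "(\<Sum>x\<in>X. d x * m x y) = 0" if "y \<in> insert y0 Y" for y
        using that c(2) x0 unfolding sum_d by (auto simp: m'_def)
      ultimately show ?thesis by blast
    qed
  qed
  with that show ?thesis by blast
qed

text \<open>
With the right-hand side adjoined as the coefficients of one more unknown, indexed by \<open>None\<close>, the
homogeneous system is underdetermined. By injectivity this unknown is nonzero in every nontrivial
solution, and dividing by it solves the original system.
\<close>

lemma square_system_solvable:
  fixes m :: "'i \<Rightarrow> 'j \<Rightarrow> 'b::field"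
  assumes "finite X" "finite Y" "card X = card Y"
    and inj: "\<And>c. (\<And>y. y \<in> Y \<Longrightarrow> (\<Sum>x\<in>X. c x * m x y) = 0) \<Longrightarrow> \<forall>x\<in>X. c x = 0"
  obtains c where "\<And>y. y \<in> Y \<Longrightarrow> (\<Sum>x\<in>X. c x * m x y) = b y"
proof -
  define m' where "m' z y = (case z of None \<Rightarrow> b y | Some x \<Rightarrow> m x y)" for z y
  have fin: "finite (insert None (Some ` X))" using assms by simp
  have card: "card Y < card (insert None (Some ` X))"
    using assms by (simp add: card_image)
  have expand: "(\<Sum>z\<in>insert None (Some ` X). c z * m' z y)
      = c None * b y + (\<Sum>x\<in>X. c (Some x) * m x y)" for c y
    using assms by (simp add: m'_def sum.reindex)
  obtain c where nz: "\<exists>z\<in>insert None (Some ` X). c z \<noteq> 0"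
    and c: "\<And>y. y \<in> Y \<Longrightarrow> c None * b y + (\<Sum>x\<in>X. c (Some x) * m x y) = 0"
    using underdetermined_system_nontrivial_solution[OF fin assms(2) card, of m']
    unfolding expand by blast
  have "c None \<noteq> 0"
  proof
    assume "c None = 0"
    then have "\<forall>x\<in>X. c (Some x) = 0" using c by (intro inj) auto
    with nz \<open>c None = 0\<close> show False by auto
  qed
  then have "(\<Sum>x\<in>X. (- c (Some x) / c None) * m x y) = b y" if "y \<in> Y" for y
  proof -
    have "(\<Sum>x\<in>X. (- c (Some x) / c None) * m x y) = - (\<Sum>x\<in>X. c (Some x) * m x y) / c None"
      by (simp add: sum_negf sum_divide_distrib)
    also have "- (\<Sum>x\<in>X. c (Some x) * m x y) = c None * b y"
      using c[OF that] by (simp only: neg_eq_iff_add_eq_0 add.commute)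
    also have "c None * b y / c None = b y" using \<open>c None \<noteq> 0\<close> by simp
    finally show ?thesis .
  qed
  then show ?thesis by (rule that)
qed

section \<open>Transversals of subgroups and orthogonality of characters\<close>

definition additive_subgroup :: "'a::ab_group_add set \<Rightarrow> bool" where
  "additive_subgroup H \<longleftrightarrow> 0 \<in> H \<and> (\<forall>x\<in>H. \<forall>y\<in>H. x - y \<in> H)"

lemma additive_subgroupD:
  assumes "additive_subgroup H"
  shows "0 \<in> H" "x \<in> H \<Longrightarrow> y \<in> H \<Longrightarrow> x - y \<in> H" "x \<in> H \<Longrightarrow> - x \<in> H"
    "x \<in> H \<Longrightarrow> y \<in> H \<Longrightarrow> x + y \<in> H"
proof -
  show 0: "0 \<in> H" and d: "x \<in> H \<Longrightarrow> y \<in> H \<Longrightarrow> x - y \<in> H" for x y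
    using assms by (auto simp: additive_subgroup_def)
  show m: "x \<in> H \<Longrightarrow> - x \<in> H" for x using d[OF 0, of x] by simp
  show "x \<in> H \<Longrightarrow> y \<in> H \<Longrightarrow> x + y \<in> H" using d[OF _ m, of x y] by simp
qed

definition coset_transversal :: "'a::ab_group_add set \<Rightarrow> 'a set \<Rightarrow> 'a set \<Rightarrow> bool" where
  "coset_transversal N M Y \<longleftrightarrow> finite Y \<and> Y \<subseteq> N \<and> (\<forall>x\<in>N. \<exists>!y. y \<in> Y \<and> x - y \<in> M)"

text \<open>
Choosing a representative of each coset gives a function that is constant on cosets; its values on \<open>N\<close>
form a transversal, which is finite because finitely many cosets cover \<open>N\<close>.
\<close>

lemma coset_transversal_exists:
  assumes M: "additive_subgroup M" and N: "additive_subgroup N" and sub: "M \<subseteq> N"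
    and cover: "finite F" "N \<subseteq> (\<Union>f\<in>F. (+) f ` M)"
  obtains Y where "coset_transversal N M Y"
proof -
  define rep where "rep x = (SOME w. x - w \<in> M)" for x
  note MD = additive_subgroupD[OF M] and ND = additive_subgroupD[OF N]
  have rep: "x - rep x \<in> M" for x
    unfolding rep_def by (rule someI[of _ x]) (simp add: MD)
  have rep_eq: "rep x = rep y" if "x - y \<in> M" for x y
  proof -
    have "x - w \<in> M \<longleftrightarrow> y - w \<in> M" for w
      using MD(2)[OF _ that, of "x - w"] MD(4)[OF that, of "y - w"] by auto
    then show ?thesis unfolding rep_def by simp
  qed
  have repN: "rep x \<in> N" if "x \<in> N" for x
    using ND(2)[OF that, of "x - rep x"] rep[of x] sub by auto
  have "rep ` N \<subseteq> rep ` F"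
  proof
    fix r assume "r \<in> rep ` N"
    then obtain x f m where "r = rep x" "f \<in> F" "m \<in> M" "x = f + m"
      using cover(2) by blast
    then show "r \<in> rep ` F" using rep_eq[of x f] by auto
  qed
  then have fin: "finite (rep ` N)" using cover(1) finite_surj by blast
  have "\<exists>!y. y \<in> rep ` N \<and> x - y \<in> M" if "x \<in> N" for x
  proof (rule ex1I[of _ "rep x"])
    show "rep x \<in> rep ` N \<and> x - rep x \<in> M" using that rep by blast
    fix y assume y: "y \<in> rep ` N \<and> x - y \<in> M"
    then obtain z where z: "z \<in> N" "y = rep z" by blast
    have "x - z \<in> M" using MD(2)[of "x - y" "z - y"] y rep[of z] z by simp
    then show "y = rep x" using rep_eq z by simp
  qed
  then have "coset_transversal N M (rep ` N)"
    unfolding coset_transversal_def using fin repN by auto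
  then show ?thesis by (rule that)
qed

lemma coset_transversal_eqI:
  assumes "coset_transversal N M Y" "y \<in> Y" "z \<in> Y" "y - z \<in> M" "0 \<in> M"
  shows "y = z"
proof -
  have "y \<in> N" using assms unfolding coset_transversal_def by auto
  then have "\<exists>!w. w \<in> Y \<and> y - w \<in> M" using assms unfolding coset_transversal_def by auto
  moreover have "y - y \<in> M" using assms by simp
  ultimately show ?thesis using assms by blast
qed

text \<open>
The algebraic part of being a character. Continuity will enter through measurability.
\<close>

definition unimodular_hom :: "('a::ab_group_add \<Rightarrow> complex) \<Rightarrow> bool" where
  "unimodular_hom \<gamma> \<longleftrightarrow> (\<forall>x. cmod (\<gamma> x) = 1) \<and> (\<forall>x y. \<gamma> (x + y) = \<gamma> x * \<gamma> y)"

lemma unimodular_homD: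
  assumes "unimodular_hom \<gamma>"
  shows "cmod (\<gamma> x) = 1" "\<gamma> (x + y) = \<gamma> x * \<gamma> y" "\<gamma> x \<noteq> 0" "\<gamma> x * cnj (\<gamma> x) = 1"
proof -
  show 1: "cmod (\<gamma> x) = 1" "\<gamma> (x + y) = \<gamma> x * \<gamma> y"
    using assms by (auto simp: unimodular_hom_def)
  show "\<gamma> x \<noteq> 0" using 1(1) by auto
  show "\<gamma> x * cnj (\<gamma> x) = 1" using 1(1) complex_norm_square[of "\<gamma> x"] by simp
qed

text \<open>
Two homomorphisms that are trivial on \<open>M\<close> live on the finite group \<open>N / M\<close>, over which the usual
orthogonality relation is summed.
\<close>

lemma character_orthogonality:
  assumes M: "additive_subgroup M" and N: "additive_subgroup N"
    and Y: "coset_transversal N M Y"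
    and \<gamma>: "unimodular_hom \<gamma>" "\<And>z. z \<in> M \<Longrightarrow> \<gamma> z = 1"
    and \<delta>: "unimodular_hom \<delta>" "\<And>z. z \<in> M \<Longrightarrow> \<delta> z = 1"
    and differ: "\<exists>y\<in>Y. \<gamma> y \<noteq> \<delta> y"
  shows "(\<Sum>y\<in>Y. \<gamma> y * cnj (\<delta> y)) = 0"
proof -
  note MD = additive_subgroupD[OF M] and ND = additive_subgroupD[OF N]
  have YN: "\<And>y. y \<in> Y \<Longrightarrow> y \<in> N" and finY: "finite Y"
    using Y unfolding coset_transversal_def by auto
  define \<theta> where "\<theta> x = \<gamma> x * cnj (\<delta> x)" for x
  have hom: "\<theta> (x + y) = \<theta> x * \<theta> y" for x y
    by (simp add: \<theta>_def unimodular_homD(2)[OF \<gamma>(1)] unimodular_homD(2)[OF \<delta>(1)])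
  have one: "\<theta> z = 1" if "z \<in> M" for z using that \<gamma> \<delta> by (simp add: \<theta>_def)
  obtain y0 where y0: "y0 \<in> Y" "\<gamma> y0 \<noteq> \<delta> y0" using differ by blast
  have "\<theta> y0 \<noteq> 1"
  proof
    assume "\<theta> y0 = 1"
    have "\<gamma> y0 = \<gamma> y0 * (\<delta> y0 * cnj (\<delta> y0))" using unimodular_homD(4)[OF \<delta>(1)] by simp
    also have "\<dots> = \<theta> y0 * \<delta> y0" by (simp add: \<theta>_def)
    also have "\<dots> = \<delta> y0" using \<open>\<theta> y0 = 1\<close> by simp
    finally show False using y0 by simp
  qed
  \<comment> \<open>Translation by \<open>y0\<close> permutes the cosets.\<close>
  have "\<forall>y\<in>Y. \<exists>w. w \<in> Y \<and> y0 + y - w \<in> M"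
    using Y ND(4) YN y0 unfolding coset_transversal_def by blast
  then obtain s where s: "\<And>y. y \<in> Y \<Longrightarrow> s y \<in> Y \<and> y0 + y - s y \<in> M" by metis
  have inj: "inj_on s Y"
  proof (rule inj_onI)
    fix x y assume xy: "x \<in> Y" "y \<in> Y" "s x = s y"
    have "x - y \<in> M"
      using MD(2)[of "y0 + x - s x" "y0 + y - s y"] s[OF xy(1)] s[OF xy(2)] xy(3) by simp
    then show "x = y" using coset_transversal_eqI[OF Y] xy MD(1) by blast
  qed
  have bij: "bij_betw s Y Y"
    using inj s finY by (intro bij_betw_imageI endo_inj_surj) auto
  have "\<theta> (s y) = \<theta> y0 * \<theta> y" if "y \<in> Y" for y
  proof -
    have "\<theta> (y0 + y) = \<theta> (s y) * \<theta> (y0 + y - s y)"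
      unfolding hom[symmetric] by (simp add: algebra_simps)
    then show ?thesis using one s[OF that] hom by simp
  qed
  then have "(\<Sum>y\<in>Y. \<theta> (s y)) = \<theta> y0 * (\<Sum>y\<in>Y. \<theta> y)"
    by (simp add: sum_distrib_left)
  moreover have "(\<Sum>y\<in>Y. \<theta> (s y)) = (\<Sum>y\<in>Y. \<theta> y)"
    by (rule sum.reindex_bij_betw[OF bij])
  ultimately have "(\<Sum>y\<in>Y. \<theta> y) = 0" using \<open>\<theta> y0 \<noteq> 1\<close> by simp
  then show ?thesis by (simp add: \<theta>_def)
qed

section \<open>The estimate for finitely many characters\<close>

text \<open>
This is the heart of the argument. The functions under consideration live on the \<open>M\<close>-cosets
contained in \<open>P + N\<close>, together with one further \<open>M\<close>-coset, that of \<open>x0\<close>; they are given by their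
coefficients \<open>g c y\<close> at \<open>c + y\<close> and \<open>a\<close> at \<open>x0\<close>. Write \<open>p\<close> for the size of \<open>P\<close> and \<open>n\<close> for the
index of \<open>M\<close> in \<open>N\<close>.

Group the characters in \<open>L\<close> into fibres, according to their restriction \<open>\<psi>\<close> to \<open>N\<close>. A function
\<open>c + y \<mapsto> b c * \<psi> y\<close> is orthogonal to every character outside the fibre of \<open>\<psi>\<close>, so the lower
bound \<open>frame\<close> makes each fibre determine \<open>p\<close> free coefficients: it has at least \<open>p\<close> elements. By the
same bound, the restrictions span the functions on a single coset of \<open>N\<close>, so there are at least \<open>n\<close>
fibres. As \<open>L\<close> has at most \<open>p * n + 2\<close> elements, at most two fibres exceed the size \<open>p\<close>, and those
contain at most \<open>2 * p + 2\<close> characters altogether.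

On a fibre of size exactly \<open>p\<close> the coefficients \<open>b c\<close> can be chosen to attain any prescribed
values. Hence the unit mass at \<open>x0\<close> can be corrected on \<open>P + N\<close> so that it becomes orthogonal to all
these fibres, without affecting the exceptional ones. Only the exceptional characters then see the
corrected function, each with modulus 1, whereas its norm is at least 1.
\<close>

lemma finite_frame_estimate:
  fixes \<alpha> m :: real
  assumes M: "additive_subgroup M" and N: "additive_subgroup N"
    and Y: "coset_transversal N M Y"
    and P: "finite P" "P \<noteq> {}"
    and fin: "finite L" and card: "card L \<le> card P * card Y + 2"
    and L: "\<And>\<gamma>. \<gamma> \<in> L \<Longrightarrow> unimodular_hom \<gamma>" "\<And>\<gamma> z. \<gamma> \<in> L \<Longrightarrow> z \<in> M \<Longrightarrow> \<gamma> z = 1"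
    and \<alpha>: "\<alpha> > 0" and m: "m \<ge> 0"
    and frame: "\<And>a g. \<alpha> * ((cmod a)\<^sup>2 + (\<Sum>c\<in>P. \<Sum>y\<in>Y. (cmod (g c y))\<^sup>2)) \<le>
        m * (\<Sum>\<gamma>\<in>L. (cmod (a * cnj (\<gamma> x0) + (\<Sum>c\<in>P. \<Sum>y\<in>Y. g c y * cnj (\<gamma> (c + y)))))\<^sup>2)"
  shows "\<alpha> \<le> m * (2 * card P + 2)"
proof -
  define p n where "p = card P" and "n = card Y"
  have finY: "finite Y" using Y unfolding coset_transversal_def by auto
  have Y0: "Y \<noteq> {}" using Y additive_subgroupD(1)[OF N] unfolding coset_transversal_def by blast
  have n0: "n > 0" using finY Y0 by (simp add: n_def card_gt_0_iff)
  have hom: "\<gamma> (x + y) = \<gamma> x * \<gamma> y" if "\<gamma> \<in> L" for \<gamma> x y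
    using unimodular_homD(2)[OF L(1)[OF that]] .
  have complete: "\<forall>c\<in>P. \<forall>y\<in>Y. g c y = 0"
    if "\<And>\<gamma>. \<gamma> \<in> L \<Longrightarrow> (\<Sum>c\<in>P. \<Sum>y\<in>Y. g c y * cnj (\<gamma> (c + y))) = 0" for g
  proof -
    have "\<alpha> * (\<Sum>c\<in>P. \<Sum>y\<in>Y. (cmod (g c y))\<^sup>2) \<le> 0"
      using frame[of 0 g] that by simp
    then have "(\<Sum>c\<in>P. \<Sum>y\<in>Y. (cmod (g c y))\<^sup>2) \<le> 0"
      using \<alpha> by (simp add: mult_le_0_iff)
    moreover have "(\<Sum>c\<in>P. \<Sum>y\<in>Y. (cmod (g c y))\<^sup>2) \<ge> 0"
      by (intro sum_nonneg) auto
    ultimately have "(\<Sum>c\<in>P. \<Sum>y\<in>Y. (cmod (g c y))\<^sup>2) = 0" by linarith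
    then show ?thesis
      using P finY by (simp add: sum_nonneg_eq_0_iff sum_nonneg)
  qed
  define res where "res \<gamma> = restrict \<gamma> Y" for \<gamma> :: "'a \<Rightarrow> complex"
  define \<Psi> where "\<Psi> = res ` L"
  define fib where "fib \<psi> = {\<gamma>\<in>L. res \<gamma> = \<psi>}" for \<psi>
  have fin\<Psi>: "finite \<Psi>" using fin by (simp add: \<Psi>_def)
  have fib_fin: "finite (fib \<psi>)" for \<psi> using fin by (simp add: fib_def)
  have fib_val: "\<gamma> y = \<psi> y" if "\<gamma> \<in> fib \<psi>" "y \<in> Y" for \<gamma> \<psi> y
    using that by (auto simp: fib_def res_def)
  have ortho: "(\<Sum>y\<in>Y. \<psi> y * cnj (\<gamma> y)) = (if \<gamma> \<in> fib \<psi> then of_nat n else 0)"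
    if \<psi>: "\<psi> \<in> \<Psi>" and \<gamma>: "\<gamma> \<in> L" for \<psi> \<gamma>
  proof -
    obtain \<delta> where \<delta>: "\<delta> \<in> L" "\<psi> = res \<delta>" using \<psi> by (auto simp: \<Psi>_def)
    have eq: "(\<Sum>y\<in>Y. \<psi> y * cnj (\<gamma> y)) = (\<Sum>y\<in>Y. \<delta> y * cnj (\<gamma> y))"
      by (intro sum.cong) (auto simp: \<delta> res_def)
    show ?thesis
    proof (cases "\<gamma> \<in> fib \<psi>")
      case True
      have "(\<Sum>y\<in>Y. \<psi> y * cnj (\<gamma> y)) = (\<Sum>y\<in>Y. 1)"
        using fib_val[OF True] unimodular_homD(4)[OF L(1)[OF \<gamma>]]
        by (intro sum.cong refl) metis
      then show ?thesis using True by (simp add: n_def)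
    next
      case False
      then have "res \<gamma> \<noteq> res \<delta>" using \<gamma> \<delta> by (auto simp: fib_def)
      then have "\<exists>y\<in>Y. \<delta> y \<noteq> \<gamma> y" unfolding res_def by (metis restrict_ext)
      then show ?thesis
        using character_orthogonality[OF M N Y L(1)[OF \<delta>(1)] L(2)[OF \<delta>(1)] L(1)[OF \<gamma>] L(2)[OF \<gamma>]]
          eq False by simp
    qed
  qed
  have product: "(\<Sum>c\<in>P. \<Sum>y\<in>Y. (b c * \<psi> y) * cnj (\<gamma> (c + y)))
      = (if \<gamma> \<in> fib \<psi> then of_nat n * (\<Sum>c\<in>P. b c * cnj (\<gamma> c)) else 0)"
    if \<psi>: "\<psi> \<in> \<Psi>" and \<gamma>: "\<gamma> \<in> L" for b \<psi> \<gamma>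
  proof -
    have "(\<Sum>c\<in>P. \<Sum>y\<in>Y. (b c * \<psi> y) * cnj (\<gamma> (c + y)))
        = (\<Sum>c\<in>P. b c * cnj (\<gamma> c)) * (\<Sum>y\<in>Y. \<psi> y * cnj (\<gamma> y))"
      unfolding sum_product by (intro sum.cong refl) (simp add: hom[OF \<gamma>] ac_simps)
    then show ?thesis using ortho[OF \<psi> \<gamma>] by simp
  qed
  \<comment> \<open>Otherwise a nonzero function supported on one coset of \<open>N\<close> would be orthogonal to \<open>L\<close>.\<close>
  have n_le: "n \<le> card \<Psi>"
  proof (rule ccontr)
    assume "\<not> n \<le> card \<Psi>"
    then have "card \<Psi> < card Y" by (simp add: n_def)
    then obtain c where nz: "\<exists>y\<in>Y. c y \<noteq> 0"
      and c: "\<And>\<psi>. \<psi> \<in> \<Psi> \<Longrightarrow> (\<Sum>y\<in>Y. c y * cnj (\<psi> y)) = 0"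
      using underdetermined_system_nontrivial_solution[OF finY fin\<Psi>, of "\<lambda>y \<psi>. cnj (\<psi> y)"]
      by blast
    obtain c0 where c0: "c0 \<in> P" using P by blast
    define g where "g d y = (if d = c0 then c y else 0)" for d y
    have "(\<Sum>d\<in>P. \<Sum>y\<in>Y. g d y * cnj (\<gamma> (d + y))) = 0" if \<gamma>: "\<gamma> \<in> L" for \<gamma>
    proof -
      have "(\<Sum>d\<in>P. \<Sum>y\<in>Y. g d y * cnj (\<gamma> (d + y)))
          = (\<Sum>d\<in>P. if d = c0 then \<Sum>y\<in>Y. c y * cnj (\<gamma> (c0 + y)) else 0)"
        by (intro sum.cong) (auto simp: g_def)
      also have "\<dots> = (\<Sum>y\<in>Y. c y * cnj (\<gamma> (c0 + y)))" using P c0 by simp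
      also have "\<dots> = cnj (\<gamma> c0) * (\<Sum>y\<in>Y. c y * cnj (res \<gamma> y))"
        by (simp add: hom[OF \<gamma>] sum_distrib_left res_def ac_simps)
      finally show ?thesis using c[of "res \<gamma>"] \<gamma> by (simp add: \<Psi>_def)
    qed
    from complete[OF this] c0 nz show False by (auto simp: g_def)
  qed
  have fib_inj: "\<forall>c\<in>P. b c = 0"
    if \<psi>: "\<psi> \<in> \<Psi>" and b: "\<And>\<gamma>. \<gamma> \<in> fib \<psi> \<Longrightarrow> (\<Sum>c\<in>P. b c * cnj (\<gamma> c)) = 0" for b \<psi>
  proof -
    have "(\<Sum>c\<in>P. \<Sum>y\<in>Y. (b c * \<psi> y) * cnj (\<gamma> (c + y))) = 0" if "\<gamma> \<in> L" for \<gamma>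
      using product[OF \<psi> that, of b] b by simp
    from complete[OF this] have *: "\<forall>c\<in>P. \<forall>y\<in>Y. b c * \<psi> y = 0" .
    obtain y where y: "y \<in> Y" using Y0 by blast
    have "\<psi> y \<noteq> 0" using \<psi> y unimodular_homD(3)[OF L(1)] by (auto simp: \<Psi>_def res_def)
    with * y show ?thesis by auto
  qed
  have p_le: "p \<le> card (fib \<psi>)" if \<psi>: "\<psi> \<in> \<Psi>" for \<psi>
  proof (rule ccontr)
    assume "\<not> p \<le> card (fib \<psi>)"
    then have "card (fib \<psi>) < card P" by (simp add: p_def)
    then obtain b where "\<exists>c\<in>P. b c \<noteq> 0"
      and "\<And>\<gamma>. \<gamma> \<in> fib \<psi> \<Longrightarrow> (\<Sum>c\<in>P. b c * cnj (\<gamma> c)) = 0"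
      using underdetermined_system_nontrivial_solution[OF P(1) fib_fin[of \<psi>], of "\<lambda>c \<gamma>. cnj (\<gamma> c)"]
      by blast
    with fib_inj[OF \<psi>] show False by blast
  qed
  \<comment> \<open>\<open>D\<close> indexes the exceptional fibres, and \<open>E\<close> counts the characters in them.\<close>
  define D where "D = {\<psi>\<in>\<Psi>. card (fib \<psi>) \<noteq> p}"
  define E where "E = (\<Sum>\<psi>\<in>D. card (fib \<psi>))"
  have DE: "E \<le> 2 * p + 2"
  proof -
    have L_eq: "L = (\<Union>\<psi>\<in>\<Psi>. fib \<psi>)" by (auto simp: \<Psi>_def fib_def)
    have "card L = (\<Sum>\<psi>\<in>\<Psi>. card (fib \<psi>))"
      unfolding L_eq using fin\<Psi> fib_fin
      by (subst card_UN_disjoint) (auto simp: fib_def)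
    also have "\<dots> = (\<Sum>\<psi>\<in>\<Psi> - D. card (fib \<psi>)) + E"
      unfolding E_def using fin\<Psi> by (subst sum.subset_diff[of D]) (auto simp: D_def)
    also have "(\<Sum>\<psi>\<in>\<Psi> - D. card (fib \<psi>)) = (\<Sum>\<psi>\<in>\<Psi> - D. p)"
      by (intro sum.cong) (auto simp: D_def)
    also have "\<dots> = p * (card \<Psi> - card D)"
      using fin\<Psi> by (simp add: card_Diff_subset D_def)
    finally have cL: "card L = p * (card \<Psi> - card D) + E" .
    have "card D \<le> card \<Psi>" using fin\<Psi> by (intro card_mono) (auto simp: D_def)
    then have "p * card \<Psi> = p * (card \<Psi> - card D) + p * card D"
      by (metis add_mult_distrib2 le_add_diff_inverse2)
    moreover have "card L \<le> p * card \<Psi> + 2"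
      using card mult_le_mono2[OF n_le, of p] unfolding p_def n_def by linarith
    ultimately have E1: "E \<le> p * card D + 2" using cL by linarith
    have "(\<Sum>\<psi>\<in>D. p + 1) \<le> E"
      unfolding E_def using p_le by (intro sum_mono) (force simp: D_def)
    then have "card D \<le> 2" using E1 by (simp add: algebra_simps)
    then have "p * card D \<le> p * 2" by (rule mult_le_mono2)
    then show ?thesis using E1 by linarith
  qed
  have "\<exists>b. \<forall>\<gamma>\<in>fib \<psi>. (\<Sum>c\<in>P. b c * cnj (\<gamma> c)) = - cnj (\<gamma> x0) / of_nat n"
    if \<psi>: "\<psi> \<in> \<Psi> - D" for \<psi>
  proof -
    have "card P = card (fib \<psi>)" using \<psi> by (auto simp: D_def p_def)
    then obtain b where "\<And>\<gamma>. \<gamma> \<in> fib \<psi> \<Longrightarrow> (\<Sum>c\<in>P. b c * cnj (\<gamma> c)) = - cnj (\<gamma> x0) / of_nat n"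
      using square_system_solvable[OF P(1) fib_fin[of \<psi>], of "\<lambda>c \<gamma>. cnj (\<gamma> c)" "\<lambda>\<gamma>. - cnj (\<gamma> x0) / of_nat n"]
        fib_inj[of \<psi>] \<psi> by blast
    then show ?thesis by blast
  qed
  then obtain b where b: "\<And>\<psi> \<gamma>. \<psi> \<in> \<Psi> - D \<Longrightarrow> \<gamma> \<in> fib \<psi> \<Longrightarrow>
      (\<Sum>c\<in>P. b \<psi> c * cnj (\<gamma> c)) = - cnj (\<gamma> x0) / of_nat n"
    by metis
  \<comment> \<open>The correction of the unit mass at \<open>x0\<close>.\<close>
  define g where "g c y = (\<Sum>\<psi>\<in>\<Psi> - D. b \<psi> c * \<psi> y)" for c y
  have coeff: "1 * cnj (\<gamma> x0) + (\<Sum>c\<in>P. \<Sum>y\<in>Y. g c y * cnj (\<gamma> (c + y)))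
      = (if res \<gamma> \<in> D then cnj (\<gamma> x0) else 0)" if \<gamma>: "\<gamma> \<in> L" for \<gamma>
  proof -
    have in_fib: "\<gamma> \<in> fib \<psi> \<longleftrightarrow> \<psi> = res \<gamma>" for \<psi> using \<gamma> by (auto simp: fib_def)
    have res: "res \<gamma> \<in> \<Psi>" using \<gamma> by (simp add: \<Psi>_def)
    have "(\<Sum>c\<in>P. \<Sum>y\<in>Y. g c y * cnj (\<gamma> (c + y)))
        = (\<Sum>c\<in>P. \<Sum>y\<in>Y. \<Sum>\<psi>\<in>\<Psi> - D. (b \<psi> c * \<psi> y) * cnj (\<gamma> (c + y)))"
      by (simp add: g_def sum_distrib_right)
    also have "\<dots> = (\<Sum>c\<in>P. \<Sum>\<psi>\<in>\<Psi> - D. \<Sum>y\<in>Y. (b \<psi> c * \<psi> y) * cnj (\<gamma> (c + y)))"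
      by (intro sum.cong refl sum.swap)
    also have "\<dots> = (\<Sum>\<psi>\<in>\<Psi> - D. \<Sum>c\<in>P. \<Sum>y\<in>Y. (b \<psi> c * \<psi> y) * cnj (\<gamma> (c + y)))"
      by (rule sum.swap)
    also have "\<dots> = (\<Sum>\<psi>\<in>\<Psi> - D. if \<psi> = res \<gamma> then of_nat n * (\<Sum>c\<in>P. b \<psi> c * cnj (\<gamma> c)) else 0)"
      using product[OF _ \<gamma>] by (intro sum.cong) (auto simp: in_fib)
    also have "\<dots> = (if res \<gamma> \<in> D then 0 else of_nat n * (\<Sum>c\<in>P. b (res \<gamma>) c * cnj (\<gamma> c)))"
      using fin\<Psi> res by (simp add: sum.delta)
    also have "\<dots> = (if res \<gamma> \<in> D then 0 else - cnj (\<gamma> x0))"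
      using b[of "res \<gamma>" \<gamma>] res in_fib n0 by simp
    finally show ?thesis by simp
  qed
  have "\<alpha> * 1 \<le> \<alpha> * ((cmod 1)\<^sup>2 + (\<Sum>c\<in>P. \<Sum>y\<in>Y. (cmod (g c y))\<^sup>2))"
    using \<alpha> by (intro mult_left_mono) (auto intro!: sum_nonneg)
  also have "\<dots> \<le> m * (\<Sum>\<gamma>\<in>L. (cmod (1 * cnj (\<gamma> x0) + (\<Sum>c\<in>P. \<Sum>y\<in>Y. g c y * cnj (\<gamma> (c + y)))))\<^sup>2)"
    by (rule frame)
  also have "(\<Sum>\<gamma>\<in>L. (cmod (1 * cnj (\<gamma> x0) + (\<Sum>c\<in>P. \<Sum>y\<in>Y. g c y * cnj (\<gamma> (c + y)))))\<^sup>2)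
      = (\<Sum>\<gamma>\<in>L. if res \<gamma> \<in> D then 1 else 0)"
    using coeff unimodular_homD(1)[OF L(1)] by (intro sum.cong refl) simp
  also have "\<dots> = card {\<gamma>\<in>L. res \<gamma> \<in> D}"
    using fin by (simp flip: sum.inter_filter)
  also have "{\<gamma>\<in>L. res \<gamma> \<in> D} = (\<Union>\<psi>\<in>D. fib \<psi>)" by (auto simp: fib_def)
  also have "card (\<Union>\<psi>\<in>D. fib \<psi>) = E"
    unfolding E_def using fin\<Psi> fib_fin
    by (subst card_UN_disjoint) (auto simp: fib_def D_def)
  also have "m * real E \<le> m * real (2 * p + 2)"
    using DE m by (intro mult_left_mono) (auto simp del: of_nat_add of_nat_mult)
  finally show ?thesis by (simp add: p_def algebra_simps)
qed

section \<open>Compact open subgroups and Haar measure\<close>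

definition compact_open_subgroup :: "'a::topological_ab_group_add set \<Rightarrow> bool" where
  "compact_open_subgroup H \<longleftrightarrow> additive_subgroup H \<and> open H \<and> compact H"

lemma mem_coset_iff: "x \<in> (+) q ` M \<longleftrightarrow> x - q \<in> M" for x :: "'a::ab_group_add"
  by (auto simp: image_iff intro!: bexI[of _ "x - q"])

lemma open_coset:
  fixes M :: "'a::topological_ab_group_add set"
  assumes "open M"
  shows "open ((+) q ` M)"
proof -
  have "(+) q ` M = (\<lambda>x. x - q) -` M" by (auto simp: mem_coset_iff)
  then show ?thesis using assms by (auto intro!: open_vimage continuous_intros)
qed

lemma coset_subset:
  assumes "additive_subgroup N" "q \<in> N" "M \<subseteq> N"
  shows "(+) q ` M \<subseteq> N"
  using additive_subgroupD(4)[OF assms(1,2)] assms(3) by auto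

lemma self_in_coset: "additive_subgroup M \<Longrightarrow> q \<in> (+) q ` M"
  by (simp add: mem_coset_iff additive_subgroupD)

text \<open>
The complement is a union of cosets.
\<close>

lemma open_subgroup_closed:
  fixes V :: "'a::topological_ab_group_add set"
  assumes V: "additive_subgroup V" "open V"
  shows "closed V"
proof -
  have "- V = (\<Union>x\<in>-V. (+) x ` V)"
  proof (intro equalityI subsetI)
    fix x assume "x \<in> (\<Union>x\<in>-V. (+) x ` V)"
    then obtain y where y: "y \<notin> V" "x - y \<in> V" by (auto simp: mem_coset_iff)
    show "x \<in> - V"
    proof
      assume "x \<in> V"
      then have "x - (x - y) \<in> V" using y V additive_subgroupD(2) by blast
      with y show False by simp
    qed
  qed (use self_in_coset[OF V(1)] in blast)
  also have "open \<dots>" using V open_coset by blast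
  finally show ?thesis by (simp add: closed_def)
qed

lemma compact_open_transversal_exists:
  assumes "compact_open_subgroup N" "compact_open_subgroup M" "M \<subseteq> N"
  obtains Y where "coset_transversal N M Y"
proof -
  have M: "additive_subgroup M" "open M" and N: "additive_subgroup N" "compact N"
    using assms by (auto simp: compact_open_subgroup_def)
  have "N \<subseteq> (\<Union>f\<in>N. (+) f ` M)" using self_in_coset[OF M(1)] by blast
  then obtain F where "F \<subseteq> N" "finite F" "N \<subseteq> (\<Union>f\<in>F. (+) f ` M)"
    using compactE_image[OF N(2), of N "\<lambda>f. (+) f ` M"] open_coset[OF M(2)] by blast
  then show ?thesis using coset_transversal_exists[OF M(1) N(1) assms(3)] that by blast
qed

lemma haar_measureD:
  assumes "haar_measure \<mu>"
  shows "sets \<mu> = sets borel" "space \<mu> = UNIV"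
    "A \<in> sets borel \<Longrightarrow> emeasure \<mu> ((+) a ` A) = emeasure \<mu> A"
    "compact K \<Longrightarrow> emeasure \<mu> K < \<infinity>"
    "emeasure \<mu> UNIV \<noteq> 0"
proof -
  show s: "sets \<mu> = sets borel" using assms by (simp add: haar_measure_def)
  show "space \<mu> = UNIV" using sets_eq_imp_space_eq[OF s] by simp
qed (use assms in \<open>auto simp: haar_measure_def\<close>)

lemma haar_integral_translate:
  fixes f :: "'a::{topological_ab_group_add, t2_space} \<Rightarrow> complex"
  assumes \<mu>: "haar_measure \<mu>" and f: "f \<in> borel_measurable borel"
  shows "(LINT x|\<mu>. f (a + x)) = (LINT x|\<mu>. f x)"
proof -
  note [measurable_cong] = haar_measureD(1)[OF \<mu>]
  have tr: "(\<lambda>x. b + x) \<in> borel_measurable borel" for b :: 'a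
    by (intro borel_measurable_continuous_onI continuous_intros)
  have t: "(\<lambda>x. a + x) \<in> measurable \<mu> borel"
    using tr haar_measureD(1)[OF \<mu>] by (metis measurable_cong_sets)
  have "distr \<mu> borel (\<lambda>x. a + x) = \<mu>"
  proof (rule measure_eqI)
    fix A assume "A \<in> sets (distr \<mu> borel (\<lambda>x. a + x))"
    then have A: "A \<in> sets borel" by simp
    have "(\<lambda>x. a + x) -` A = (+) (- a) ` A"
      by (intro set_eqI) (unfold mem_coset_iff vimage_eq, simp add: add.commute)
    then have "emeasure \<mu> ((\<lambda>x. a + x) -` A) = emeasure \<mu> A"
      using haar_measureD(3)[OF \<mu> A] by metis
    then show "emeasure (distr \<mu> borel (\<lambda>x. a + x)) A = emeasure \<mu> A"
      using t A haar_measureD(2)[OF \<mu>] by (simp add: emeasure_distr)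
  qed (simp add: haar_measureD(1)[OF \<mu>])
  then show ?thesis using integral_distr[OF t f] by simp
qed

lemma compact_open_subgroup_coset_measure:
  assumes \<mu>: "haar_measure \<mu>" and M: "compact_open_subgroup M"
  shows "(+) q ` M \<in> sets \<mu>" "emeasure \<mu> ((+) q ` M) < \<infinity>"
    "measure \<mu> ((+) q ` M) = measure \<mu> M"
proof -
  have o: "open M" and c: "compact M" using M by (auto simp: compact_open_subgroup_def)
  show "(+) q ` M \<in> sets \<mu>"
    using borel_open[OF open_coset[OF o]] haar_measureD(1)[OF \<mu>] by blast
  have e: "emeasure \<mu> ((+) q ` M) = emeasure \<mu> M"
    using haar_measureD(3)[OF \<mu>] borel_open[OF o] by blast
  then show "emeasure \<mu> ((+) q ` M) < \<infinity>" using haar_measureD(4)[OF \<mu> c] by simp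
  show "measure \<mu> ((+) q ` M) = measure \<mu> M" using e by (simp add: measure_def)
qed

lemma compact_open_subgroup_measure:
  assumes \<mu>: "haar_measure \<mu>" and M: "compact_open_subgroup M"
  shows "M \<in> sets \<mu>" "emeasure \<mu> M < \<infinity>"
  using compact_open_subgroup_coset_measure[OF assms, of 0] by simp_all

text \<open>
By separability, countably many translates of an open subgroup cover the group, so a null open
subgroup would make the whole measure vanish.
\<close>

lemma open_subgroup_measure_pos:
  fixes \<mu> :: "'a::{topological_ab_group_add, t2_space} measure"
  assumes \<mu>: "haar_measure \<mu>" and sep: "separable_space (euclidean :: 'a topology)"
    and M: "additive_subgroup M" "open M"
  shows "emeasure \<mu> M > 0"
proof (rule ccontr)
  assume "\<not> emeasure \<mu> M > 0"
  then have null: "emeasure \<mu> M = 0" by (simp add: not_gr_zero)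
  obtain C :: "'a set" where C: "countable C" "closure C = UNIV"
    using sep unfolding separable_space_def by auto
  have "UNIV = (\<Union>c\<in>C. (+) c ` M)"
  proof (intro equalityI subsetI)
    fix x :: 'a
    have "open ((+) x ` M)" "x \<in> (+) x ` M" using M open_coset self_in_coset by blast+
    then obtain c where c: "c \<in> C" "c \<in> (+) x ` M"
      using C(2) by (metis UNIV_I closure_iff_nhds_not_empty disjoint_iff subset_refl)
    then have "x - c \<in> M"
      using additive_subgroupD(3)[OF M(1), of "c - x"] by (simp add: mem_coset_iff)
    then show "x \<in> (\<Union>c\<in>C. (+) c ` M)" using c by (auto simp: mem_coset_iff)
  qed simp
  moreover have "(\<Union>c\<in>C. (+) c ` M) \<in> null_sets \<mu>"
  proof (rule null_sets_UN'[OF C(1)])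
    fix c
    show "(+) c ` M \<in> null_sets \<mu>"
      using null haar_measureD(1)[OF \<mu>] haar_measureD(3)[OF \<mu> borel_open[OF M(2)]]
        borel_open[OF open_coset[OF M(2)]] by (intro null_setsI) auto
  qed
  ultimately show False using haar_measureD(5)[OF \<mu>] by (metis null_setsD1)
qed

lemma separated_cosets_measure_le:
  assumes \<mu>: "haar_measure \<mu>" and M: "compact_open_subgroup M" and N: "compact_open_subgroup N"
    and sub: "M \<subseteq> N" and Z: "finite Z" "Z \<subseteq> N"
    and sep: "\<And>x y. x \<in> Z \<Longrightarrow> y \<in> Z \<Longrightarrow> x - y \<in> M \<Longrightarrow> x = y"
  shows "card Z * measure \<mu> M \<le> measure \<mu> N"
proof -
  have Ms: "additive_subgroup M" and Ns: "additive_subgroup N"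
    using M N by (auto simp: compact_open_subgroup_def)
  have dis: "disjoint_family_on (\<lambda>z. (+) z ` M) Z"
    unfolding disjoint_family_on_def
  proof (intro ballI impI)
    fix x y assume xy: "x \<in> Z" "y \<in> Z" "x \<noteq> y"
    have False if "w - x \<in> M" "w - y \<in> M" for w
      using additive_subgroupD(2)[OF Ms that(2,1)] sep[OF xy(1,2)] xy(3) by simp
    then show "(+) x ` M \<inter> (+) y ` M = {}" unfolding disjoint_iff mem_coset_iff by blast
  qed
  have "measure \<mu> (\<Union>z\<in>Z. (+) z ` M) = (\<Sum>z\<in>Z. measure \<mu> ((+) z ` M))"
    using compact_open_subgroup_coset_measure[OF \<mu> M] Z(1) dis
    by (intro measure_finite_Union) (auto simp: less_top)
  also have "\<dots> = card Z * measure \<mu> M"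
    using compact_open_subgroup_coset_measure(3)[OF \<mu> M] by simp
  finally have "card Z * measure \<mu> M = measure \<mu> (\<Union>z\<in>Z. (+) z ` M)" by simp
  also have "\<dots> \<le> measure \<mu> N"
  proof (rule measure_mono_fmeasurable)
    show "(\<Union>z\<in>Z. (+) z ` M) \<subseteq> N" using coset_subset[OF Ns _ sub] Z by blast
    show "(\<Union>z\<in>Z. (+) z ` M) \<in> sets \<mu>"
      using compact_open_subgroup_coset_measure(1)[OF \<mu> M] Z by blast
    show "N \<in> fmeasurable \<mu>"
      using compact_open_subgroup_measure[OF \<mu> N] by (intro fmeasurableI) auto
  qed
  finally show ?thesis .
qed

lemma charactersD:
  assumes "\<gamma> \<in> characters"
  shows "unimodular_hom \<gamma>" "\<gamma> \<in> borel_measurable borel"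
  using assms by (auto simp: characters_def unimodular_hom_def intro: borel_measurable_continuous_onI)

text \<open>
A translation by an element of \<open>M\<close> preserves the integral over \<open>M\<close> but multiplies it by a value of
the character, which forces the integral of a character that is nontrivial on \<open>M\<close> to be zero.
\<close>

lemma coset_character_integral:
  fixes \<mu> :: "'a::{topological_ab_group_add, t2_space} measure"
  assumes \<mu>: "haar_measure \<mu>" and M: "compact_open_subgroup M" and \<gamma>: "\<gamma> \<in> characters"
  shows "integrable \<mu> (\<lambda>x. indicator ((+) q ` M) x * cnj (\<gamma> x))" (is ?int)
    and "(LINT x|\<mu>. indicator ((+) q ` M) x * cnj (\<gamma> x)) =
      (if \<forall>z\<in>M. \<gamma> z = 1 then measure \<mu> M * cnj (\<gamma> q) else 0)" (is ?val)
proof -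
  have Ms: "additive_subgroup M" and o: "open M" using M by (auto simp: compact_open_subgroup_def)
  note hom = unimodular_homD[OF charactersD(1)[OF \<gamma>]]
  note [measurable] = charactersD(2)[OF \<gamma>]
  have [measurable]: "(+) q ` M \<in> sets borel" for q
    by (intro borel_open open_coset o)
  define f where "f q x = indicator ((+) q ` M) x * cnj (\<gamma> x)" for q x
  have f_meas: "f q \<in> borel_measurable borel" for q unfolding f_def by measurable
  then have f_meas': "f q \<in> borel_measurable \<mu>" for q
    using haar_measureD(1)[OF \<mu>] by (metis measurable_cong_sets)
  have "integrable \<mu> (indicator ((+) q ` M) :: 'a \<Rightarrow> real)"
    using compact_open_subgroup_coset_measure[OF \<mu> M, of q] by simp
  then show ?int
    using f_meas'[of q] unfolding f_def[symmetric]
    by (rule Bochner_Integration.integrable_bound)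
       (auto simp: f_def norm_mult hom(1) indicator_def)
  define I where "I q = (LINT x|\<mu>. f q x)" for q
  have shift: "I (a + q) = cnj (\<gamma> a) * I q" for a q
  proof -
    have mem: "a + x \<in> (+) (a + q) ` M \<longleftrightarrow> x \<in> (+) q ` M" for x
      unfolding mem_coset_iff by simp
    have "I (a + q) = (LINT x|\<mu>. f (a + q) (a + x))"
      unfolding I_def by (rule haar_integral_translate[OF \<mu> f_meas, symmetric])
    also have "\<dots> = (LINT x|\<mu>. cnj (\<gamma> a) * f q x)"
      by (intro Bochner_Integration.integral_cong refl)
         (simp add: f_def hom(2) indicator_def mem)
    finally show ?thesis by (simp add: I_def)
  qed
  have "I q = (if \<forall>z\<in>M. \<gamma> z = 1 then measure \<mu> M * cnj (\<gamma> q) else 0)"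
  proof (cases "\<forall>z\<in>M. \<gamma> z = 1")
    case True
    have "f 0 = (\<lambda>x. of_real (indicator M x))"
      using True by (auto simp: f_def indicator_def fun_eq_iff)
    then have "I 0 = measure \<mu> M"
      unfolding I_def using haar_measureD(2)[OF \<mu>] by simp
    then show ?thesis using True shift[of q 0] by simp
  next
    case False
    then obtain z where z: "z \<in> M" "\<gamma> z \<noteq> 1" by blast
    have "(+) z ` M = M"
    proof (rule set_eqI)
      fix x
      show "x \<in> (+) z ` M \<longleftrightarrow> x \<in> M"
        unfolding mem_coset_iff
        using additive_subgroupD(4)[OF Ms z(1), of "x - z"] additive_subgroupD(2)[OF Ms _ z(1), of x]
        by auto
    qed
    then have "I (z + 0) = I 0" by (simp add: I_def f_def)
    then have "cnj (\<gamma> z) * I 0 = 1 * I 0" using shift[of z 0] by simp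
    moreover have "cnj (\<gamma> z) \<noteq> 1" using z by (metis complex_cnj_cnj complex_cnj_one)
    ultimately have "I 0 = 0" by (metis mult_cancel_right)
    then have "I q = 0" using shift[of q 0] by simp
    with False show ?thesis by (simp only: if_False)
  qed
  then show ?val by (simp add: I_def f_def)
qed

text \<open>
A character is either constant on every coset of \<open>M\<close> or integrates to zero over each of them. So only
characters trivial on \<open>M\<close> see a step function on cosets of \<open>M\<close>, and for these the inner product is a
finite sum over the representatives.
\<close>

lemma coset_step_function:
  fixes \<mu> :: "'a::{topological_ab_group_add, t2_space} measure"
    and k :: "'i \<Rightarrow> complex"
  assumes \<mu>: "haar_measure \<mu>" and M: "compact_open_subgroup M" and \<Omega>: "open \<Omega>"
    and I: "finite I" and sub: "\<And>i. i \<in> I \<Longrightarrow> (+) (q i) ` M \<subseteq> \<Omega>"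
    and sep: "\<And>i j. i \<in> I \<Longrightarrow> j \<in> I \<Longrightarrow> q i - q j \<in> M \<Longrightarrow> i = j"
  defines "h \<equiv> \<lambda>x. \<Sum>i\<in>I. k i * indicator ((+) (q i) ` M) x"
  shows "h \<in> L2 (restrict_space \<mu> \<Omega>)" (is ?L2)
    and "(L2_norm (restrict_space \<mu> \<Omega>) h)\<^sup>2 = measure \<mu> M * (\<Sum>i\<in>I. (cmod (k i))\<^sup>2)" (is ?norm)
    and "\<gamma> \<in> characters \<Longrightarrow> L2_inner (restrict_space \<mu> \<Omega>) h (restrict \<gamma> \<Omega>) =
      (if \<forall>z\<in>M. \<gamma> z = 1 then measure \<mu> M * (\<Sum>i\<in>I. k i * cnj (\<gamma> (q i))) else 0)" (is "_ \<Longrightarrow> ?inner")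
proof -
  have Ms: "additive_subgroup M" using M by (auto simp: compact_open_subgroup_def)
  have \<Omega>s: "\<Omega> \<inter> space \<mu> \<in> sets \<mu>"
    using \<Omega> haar_measureD(1,2)[OF \<mu>] by simp
  note coset = compact_open_subgroup_coset_measure[OF \<mu> M]
  note [measurable] = coset(1)
  have h_meas: "h \<in> borel_measurable \<mu>" unfolding h_def by measurable
  have square: "(cmod (h x))\<^sup>2 = (\<Sum>i\<in>I. (cmod (k i))\<^sup>2 * indicator ((+) (q i) ` M) x)" for x
  proof (cases "\<exists>j\<in>I. x \<in> (+) (q j) ` M")
    case True
    then obtain j where j: "j \<in> I" "x - q j \<in> M" by (auto simp: mem_coset_iff)
    have ind: "x \<in> (+) (q i) ` M \<longleftrightarrow> i = j" if "i \<in> I" for i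
      using sep[OF that j(1)] additive_subgroupD(2)[OF Ms j(2), of "x - q i"] j
      by (auto simp: mem_coset_iff)
    have "h x = (\<Sum>i\<in>I. if i = j then k i else 0)"
      unfolding h_def by (intro sum.cong) (auto simp: indicator_def ind)
    moreover have "(\<Sum>i\<in>I. (cmod (k i))\<^sup>2 * indicator ((+) (q i) ` M) x) = (\<Sum>i\<in>I. if i = j then (cmod (k i))\<^sup>2 else 0)"
      by (intro sum.cong) (auto simp: indicator_def ind)
    ultimately show ?thesis using I j(1) by simp
  next
    case False
    then show ?thesis by (simp add: h_def indicator_def)
  qed
  have outside: "x \<notin> (+) (q i) ` M" if "x \<notin> \<Omega>" "i \<in> I" for i x
    using sub[OF that(2)] that(1) by blast
  have sq\<Omega>: "indicator \<Omega> x *\<^sub>R (cmod (h x))\<^sup>2 = (\<Sum>i\<in>I. (cmod (k i))\<^sup>2 * indicator ((+) (q i) ` M) x)" for x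
    unfolding square using outside[of x] by (cases "x \<in> \<Omega>") (simp_all add: indicator_def)
  have int: "integrable \<mu> (\<lambda>x. indicator ((+) (q i) ` M) x :: real)" for i
    using coset[of "q i"] by simp
  have "integrable (restrict_space \<mu> \<Omega>) (\<lambda>x. (cmod (h x))\<^sup>2)"
    unfolding integrable_restrict_space[OF \<Omega>s] sq\<Omega> using int by simp
  then show ?L2
    using measurable_restrict_space1[OF h_meas] by (simp add: L2_def)
  show ?norm
    unfolding L2_norm_square using int coset(3) haar_measureD(2)[OF \<mu>]
    unfolding integral_restrict_space[OF \<Omega>s] sq\<Omega> by (simp add: sum_distrib_left mult.commute)
  assume \<gamma>: "\<gamma> \<in> characters"
  have inner\<Omega>: "indicator \<Omega> x *\<^sub>R (h x * cnj (restrict \<gamma> \<Omega> x))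
      = (\<Sum>i\<in>I. k i * (indicator ((+) (q i) ` M) x * cnj (\<gamma> x)))" for x
  proof (cases "x \<in> \<Omega>")
    case True
    then show ?thesis by (simp add: h_def sum_distrib_right mult.assoc)
  next
    case False
    then show ?thesis using outside[of x] by (simp add: indicator_def)
  qed
  have "L2_inner (restrict_space \<mu> \<Omega>) h (restrict \<gamma> \<Omega>)
      = (\<Sum>i\<in>I. k i * (LINT x|\<mu>. indicator ((+) (q i) ` M) x * cnj (\<gamma> x)))"
    unfolding L2_inner_def integral_restrict_space[OF \<Omega>s] inner\<Omega>
    using coset_character_integral(1)[OF \<mu> M \<gamma>]
    by (subst Bochner_Integration.integral_sum) auto
  then have inner: "L2_inner (restrict_space \<mu> \<Omega>) h (restrict \<gamma> \<Omega>)
      = (\<Sum>i\<in>I. k i * (if \<forall>z\<in>M. \<gamma> z = 1 then measure \<mu> M * cnj (\<gamma> (q i)) else 0))"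
    unfolding coset_character_integral(2)[OF \<mu> M \<gamma>] .
  show ?inner
  proof (cases "\<forall>z\<in>M. \<gamma> z = 1")
    case True
    then show ?thesis
      unfolding inner if_P[OF True] by (simp add: sum_distrib_left mult.left_commute)
  next
    case False
    then show ?thesis unfolding inner if_not_P[OF False] by simp
  qed
qed

section \<open>A Riesz basis bounds the index of consecutive scales\<close>

text \<open>
Members of a Riesz basis that are trivial on \<open>M\<close> are determined on \<open>\<Omega>\<close> by their values at the points
of \<open>K\<close>, so linear independence limits their number to that of these points.
\<close>

lemma trivial_characters_card_le:
  fixes \<mu> :: "'a::{topological_ab_group_add, t2_space} measure"
  assumes riesz: "L2_riesz_basis (restrict_space \<mu> \<Omega>) \<Lambda> (\<lambda>\<gamma>. restrict \<gamma> \<Omega>)"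
    and \<Lambda>: "\<Lambda> \<subseteq> characters" and K: "finite K" "\<Omega> \<subseteq> (\<Union>q\<in>K. (+) q ` M)"
  shows "finite {\<gamma>\<in>\<Lambda>. \<forall>z\<in>M. \<gamma> z = 1} \<and> card {\<gamma>\<in>\<Lambda>. \<forall>z\<in>M. \<gamma> z = 1} \<le> card K"
proof (rule finite_if_finite_subsets_card_bdd)
  fix F assume F: "F \<subseteq> {\<gamma>\<in>\<Lambda>. \<forall>z\<in>M. \<gamma> z = 1}" "finite F"
  show "card F \<le> card K"
  proof (rule ccontr)
    assume "\<not> card F \<le> card K"
    then have "card K < card F" by simp
    then obtain c where nz: "\<exists>\<gamma>\<in>F. c \<gamma> \<noteq> 0"
      and c: "\<And>q. q \<in> K \<Longrightarrow> (\<Sum>\<gamma>\<in>F. c \<gamma> * \<gamma> q) = 0"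
      using underdetermined_system_nontrivial_solution[OF F(2) K(1), of "\<lambda>\<gamma> q. \<gamma> q"] by blast
    have "(\<Sum>\<gamma>\<in>F. c \<gamma> * restrict \<gamma> \<Omega> x) = 0" if x: "x \<in> \<Omega>" for x
    proof -
      obtain q where q: "q \<in> K" "x - q \<in> M" using K(2) x by (auto simp: mem_coset_iff)
      have "\<gamma> x = \<gamma> q" if \<gamma>: "\<gamma> \<in> F" for \<gamma>
      proof -
        have "\<gamma> \<in> characters" "\<gamma> (x - q) = 1" using \<gamma> F(1) \<Lambda> q(2) by blast+
        then show ?thesis
          using unimodular_homD(2)[OF charactersD(1), of \<gamma> q "x - q"] by simp
      qed
      then have "(\<Sum>\<gamma>\<in>F. c \<gamma> * restrict \<gamma> \<Omega> x) = (\<Sum>\<gamma>\<in>F. c \<gamma> * \<gamma> q)"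
        using x by (intro sum.cong) auto
      then show ?thesis using c[OF q(1)] by simp
    qed
    then have "AE x in restrict_space \<mu> \<Omega>. (\<Sum>\<gamma>\<in>F. c \<gamma> * restrict \<gamma> \<Omega> x) = 0"
      by (intro AE_I2) (simp add: space_restrict_space)
    with riesz_basis_independent[OF riesz F(2)] F(1) nz show False by auto
  qed
qed

lemma sum_insert_None_Times:
  assumes "finite P" "finite Y"
  shows "(\<Sum>i\<in>insert None (Some ` (P \<times> Y)). F i)
    = F None + (\<Sum>c\<in>P. \<Sum>y\<in>Y. F (Some (c, y)))"
  using assms by (simp add: sum.reindex sum.cartesian_product case_prod_unfold)

text \<open>
The set \<open>\<Omega>\<close> splits into a coarse part \<open>\<Omega>'\<close> made of cosets of \<open>N\<close>, a single coset of \<open>M\<close> inside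
\<open>N\<close>, and an arbitrary remainder inside \<open>M\<close>. The remainder is invisible in the
lower bound for functions supported on the first two parts, and it raises the upper bound for the
number of characters trivial on \<open>M\<close> only by one. The finite estimate therefore applies. It bounds
\<open>\<alpha>\<close> by \<open>measure \<mu> M\<close> times twice the number of cosets of \<open>N\<close> in \<open>\<Omega>' \<union> N\<close>; comparing
volumes inside \<open>H\<close> yields a bound for the index, expressed by an \<open>M\<close>-separated subset \<open>Z\<close> of \<open>N\<close>.
\<close>

lemma riesz_lower_bound_index_le:
  fixes \<mu> :: "'a::{topological_ab_group_add, t2_space} measure"
  assumes \<mu>: "haar_measure \<mu>"
    and H: "compact_open_subgroup H" and N: "compact_open_subgroup N"
    and M: "compact_open_subgroup M" and pos: "measure \<mu> M > 0"
    and sub: "M \<subseteq> N" "N \<subseteq> H"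
    and \<Omega>: "open \<Omega>" "\<Omega>' \<union> (+) b ` M \<subseteq> \<Omega>" "\<Omega> \<subseteq> \<Omega>' \<union> (+) b ` M \<union> M"
    and b: "b \<in> N" "b \<notin> M"
    and \<Omega>': "\<Omega>' \<subseteq> H - N" "\<Omega>' \<noteq> {}" "\<And>x z. x \<in> \<Omega>' \<Longrightarrow> z \<in> N \<Longrightarrow> x + z \<in> \<Omega>'"
    and \<Lambda>: "\<Lambda> \<subseteq> characters"
    and riesz: "L2_riesz_basis (restrict_space \<mu> \<Omega>) \<Lambda> (\<lambda>\<gamma>. restrict \<gamma> \<Omega>)"
    and \<alpha>: "\<alpha> > 0"
    and frame: "\<And>h J. h \<in> L2 (restrict_space \<mu> \<Omega>) \<Longrightarrow> finite J \<Longrightarrow> J \<subseteq> \<Lambda> \<Longrightarrow>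
       (\<And>\<gamma>. \<gamma> \<in> \<Lambda> - J \<Longrightarrow> L2_inner (restrict_space \<mu> \<Omega>) h (restrict \<gamma> \<Omega>) = 0) \<Longrightarrow>
       \<alpha> * (L2_norm (restrict_space \<mu> \<Omega>) h)\<^sup>2
         \<le> (\<Sum>\<gamma>\<in>J. (cmod (L2_inner (restrict_space \<mu> \<Omega>) h (restrict \<gamma> \<Omega>)))\<^sup>2)"
    and Z: "finite Z" "Z \<subseteq> N" "\<And>x y. x \<in> Z \<Longrightarrow> y \<in> Z \<Longrightarrow> x - y \<in> M \<Longrightarrow> x = y"
  shows "\<alpha> * card Z \<le> 2 * measure \<mu> H"
proof -
  have Hs: "additive_subgroup H" and Ns: "additive_subgroup N" and Ms: "additive_subgroup M"
    using H N M by (auto simp: compact_open_subgroup_def)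
  note HD = additive_subgroupD[OF Hs] and ND = additive_subgroupD[OF Ns] and MD = additive_subgroupD[OF Ms]
  obtain Y where Y: "coset_transversal N M Y"
    using compact_open_transversal_exists[OF N M sub(1)] .
  obtain P' where P': "coset_transversal H N P'"
    using compact_open_transversal_exists[OF H N sub(2)] .
  define P where "P = P' \<inter> \<Omega>'"
  have finY: "finite Y" and YN: "Y \<subseteq> N" using Y by (auto simp: coset_transversal_def)
  have finP: "finite P" and PH: "P \<subseteq> H" using P' by (auto simp: coset_transversal_def P_def)
  have P_sep: "c = d" if "c \<in> P" "d \<in> P" "c - d \<in> N" for c d
    using coset_transversal_eqI[OF P', of c d] that ND(1) by (auto simp: P_def)
  have Y_sep: "y = z" if "y \<in> Y" "z \<in> Y" "y - z \<in> M" for y z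
    using coset_transversal_eqI[OF Y, of y z] that MD(1) by blast
  have P_cover: "\<exists>c\<in>P. x - c \<in> N" if x: "x \<in> \<Omega>'" for x
  proof -
    obtain c where c: "c \<in> P'" "x - c \<in> N"
      using P' x \<Omega>'(1) unfolding coset_transversal_def by blast
    have "c = x + (- (x - c))" by simp
    then have "c \<in> \<Omega>'" using \<Omega>'(3)[OF x ND(3)[OF c(2)]] by metis
    then show ?thesis using c by (auto simp: P_def)
  qed
  have P0: "P \<noteq> {}" using P_cover \<Omega>'(2) by blast
  \<comment> \<open>Representatives of the \<open>M\<close>-cosets that make up \<open>\<Omega>'\<close> and \<open>b + M\<close>.\<close>
  define I where "I = insert None (Some ` (P \<times> Y))"
  define q where "q i = (case i of None \<Rightarrow> b | Some (c, y) \<Rightarrow> c + y)" for i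
  have finI: "finite I" using finP finY by (simp add: I_def)
  have q_simps: "q None = b" "q (Some (c, y)) = c + y" for c y by (simp_all add: q_def)
  note expand = sum_insert_None_Times[OF finP finY, folded I_def]
  have in\<Omega>': "c + y \<in> \<Omega>'" if "c \<in> P" "y \<in> N" for c y
    using \<Omega>'(3) that by (auto simp: P_def)
  have q_sub: "(+) (q i) ` M \<subseteq> \<Omega>" if "i \<in> I" for i
  proof (cases i)
    case None
    then show ?thesis using \<Omega>(2) by (simp add: q_def)
  next
    case (Some a)
    then obtain c y where cy: "i = Some (c, y)" "c \<in> P" "y \<in> Y" using \<open>i \<in> I\<close> by (auto simp: I_def)
    have "c + y + z \<in> \<Omega>'" if "z \<in> M" for z
      using in\<Omega>'[OF cy(2), of "y + z"] ND(4)[of y z] YN cy(3) that sub(1) by (auto simp: add.assoc)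
    then show ?thesis using \<Omega>(2) cy(1) by (auto simp: q_simps)
  qed
  have q_sep: "i = j" if "i \<in> I" "j \<in> I" "q i - q j \<in> M" for i j
  proof -
    \<comment> \<open>The coset of \<open>b\<close> lies in \<open>N\<close>, whereas the others avoid \<open>N\<close>.\<close>
    have mixed: "b - (c + y) \<notin> M" if cy: "c \<in> P" "y \<in> Y" for c y
    proof
      assume "b - (c + y) \<in> M"
      then have "c + y \<in> N" using ND(2)[OF b(1), of "b - (c + y)"] sub(1) by (auto simp: add.commute)
      moreover have "c + y \<notin> N" using in\<Omega>'[OF cy(1)] cy(2) YN \<Omega>'(1) by blast
      ultimately show False by simp
    qed
    have mixed': "(c + y) - b \<notin> M" if cy: "c \<in> P" "y \<in> Y" for c y
      using mixed[OF cy] MD(3)[of "(c + y) - b"] by auto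
    have same: "c = d \<and> y = z"
      if cy: "c \<in> P" "y \<in> Y" "d \<in> P" "z \<in> Y" and in_M: "(c + y) - (d + z) \<in> M" for c y d z
    proof -
      have "(c + y - (d + z)) - (y - z) \<in> N"
        by (rule ND(2)[OF subsetD[OF sub(1) in_M] ND(2)]) (use YN cy in auto)
      then have "c - d \<in> N" by (simp add: algebra_simps)
      then have "c = d" using P_sep cy by blast
      then show ?thesis using Y_sep[OF cy(2,4)] in_M by simp
    qed
    show ?thesis using that mixed mixed' same by (auto simp: I_def q_simps)
  qed
  define L where "L = {\<gamma>\<in>\<Lambda>. \<forall>z\<in>M. \<gamma> z = 1}"
  have L_bound: "finite L \<and> card L \<le> card P * card Y + 2"
  proof -
    \<comment> \<open>The point 0 represents the coset \<open>M\<close> that contains the remainder of \<open>\<Omega>\<close>.\<close>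
    have "\<Omega> \<subseteq> (\<Union>r\<in>insert 0 (q ` I). (+) r ` M)"
    proof
      fix x assume "x \<in> \<Omega>"
      then consider "x \<in> \<Omega>'" | "x - b \<in> M" | "x \<in> M"
        using \<Omega>(3) by (auto simp: mem_coset_iff)
      then show "x \<in> (\<Union>r\<in>insert 0 (q ` I). (+) r ` M)"
      proof cases
        case 1
        then obtain c where c: "c \<in> P" "x - c \<in> N" using P_cover by blast
        then obtain y where y: "y \<in> Y" "x - c - y \<in> M"
          using Y unfolding coset_transversal_def by blast
        then have "Some (c, y) \<in> I" "x - q (Some (c, y)) \<in> M"
          using c by (auto simp: I_def q_simps diff_diff_eq)
        then show ?thesis unfolding UN_iff mem_coset_iff by blast
      next
        case 2
        then have "None \<in> I" "x - q None \<in> M" by (auto simp: I_def q_simps)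
        then show ?thesis unfolding UN_iff mem_coset_iff by blast
      next
        case 3
        then have "x - 0 \<in> M" by simp
        then show ?thesis unfolding UN_iff mem_coset_iff by blast
      qed
    qed
    then have "finite L \<and> card L \<le> card (insert 0 (q ` I))"
      unfolding L_def by (intro trivial_characters_card_le[OF riesz \<Lambda>]) (use finI in auto)
    moreover have "card (insert 0 (q ` I)) \<le> Suc (card I)"
      using card_insert_le_m1[of "Suc (card I)" "q ` I" 0] card_image_le[OF finI, of q] by simp
    moreover have "card I = Suc (card P * card Y)"
      unfolding I_def using finP finY by (simp add: card_image card_cartesian_product)
    ultimately show ?thesis by simp
  qed
  let ?R = "restrict_space \<mu> \<Omega>"
  have "\<alpha> \<le> measure \<mu> M * (2 * card P + 2)"
  proof (rule finite_frame_estimate[OF Ms Ns Y finP P0])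
    fix a :: complex and g :: "'a \<Rightarrow> 'a \<Rightarrow> complex"
    define k where "k i = (case i of None \<Rightarrow> a | Some (c, y) \<Rightarrow> g c y)" for i
    define h where "h = (\<lambda>x. \<Sum>i\<in>I. k i * indicator ((+) (q i) ` M) x)"
    have step: "h \<in> L2 ?R"
      "(L2_norm ?R h)\<^sup>2 = measure \<mu> M * (\<Sum>i\<in>I. (cmod (k i))\<^sup>2)"
      "\<And>\<gamma>. \<gamma> \<in> characters \<Longrightarrow> L2_inner ?R h (restrict \<gamma> \<Omega>) =
        (if \<forall>z\<in>M. \<gamma> z = 1 then measure \<mu> M * (\<Sum>i\<in>I. k i * cnj (\<gamma> (q i))) else 0)"
      unfolding h_def
      by (rule coset_step_function[OF \<mu> M \<Omega>(1) finI q_sub q_sep]; assumption)+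
    let ?S = "\<lambda>\<gamma>. a * cnj (\<gamma> b) + (\<Sum>c\<in>P. \<Sum>y\<in>Y. g c y * cnj (\<gamma> (c + y)))"
    have inner: "L2_inner ?R h (restrict \<gamma> \<Omega>) = (if \<gamma> \<in> L then measure \<mu> M * ?S \<gamma> else 0)"
      if \<gamma>: "\<gamma> \<in> \<Lambda>" for \<gamma>
    proof -
      have mem: "\<gamma> \<in> L \<longleftrightarrow> (\<forall>z\<in>M. \<gamma> z = 1)" using \<gamma> by (simp add: L_def)
      have S: "(\<Sum>i\<in>I. k i * cnj (\<gamma> (q i))) = ?S \<gamma>"
        unfolding expand by (simp add: k_def q_simps)
      show ?thesis using step(3)[OF subsetD[OF \<Lambda> \<gamma>]] unfolding mem S .
    qed
    have norm: "(L2_norm ?R h)\<^sup>2 = measure \<mu> M * ((cmod a)\<^sup>2 + (\<Sum>c\<in>P. \<Sum>y\<in>Y. (cmod (g c y))\<^sup>2))"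
      using step(2) by (simp add: expand k_def)
    have "\<alpha> * (L2_norm ?R h)\<^sup>2 \<le> (\<Sum>\<gamma>\<in>L. (cmod (L2_inner ?R h (restrict \<gamma> \<Omega>)))\<^sup>2)"
      using L_bound inner step(1) by (intro frame) (auto simp: L_def)
    also have "\<dots> = (\<Sum>\<gamma>\<in>L. (measure \<mu> M)\<^sup>2 * (cmod (?S \<gamma>))\<^sup>2)"
      using inner by (intro sum.cong refl) (auto simp: L_def norm_mult power_mult_distrib)
    also have "\<dots> = measure \<mu> M * (measure \<mu> M * (\<Sum>\<gamma>\<in>L. (cmod (?S \<gamma>))\<^sup>2))"
      by (simp add: sum_distrib_left power2_eq_square mult.assoc)
    finally have "measure \<mu> M * (\<alpha> * ((cmod a)\<^sup>2 + (\<Sum>c\<in>P. \<Sum>y\<in>Y. (cmod (g c y))\<^sup>2)))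
        \<le> measure \<mu> M * (measure \<mu> M * (\<Sum>\<gamma>\<in>L. (cmod (?S \<gamma>))\<^sup>2))"
      unfolding norm by (simp only: mult.left_commute)
    then show "\<alpha> * ((cmod a)\<^sup>2 + (\<Sum>c\<in>P. \<Sum>y\<in>Y. (cmod (g c y))\<^sup>2))
        \<le> measure \<mu> M * (\<Sum>\<gamma>\<in>L. (cmod (?S \<gamma>))\<^sup>2)"
      using pos by (simp only: mult_le_cancel_left_pos)
  next
    show "\<And>\<gamma>. \<gamma> \<in> L \<Longrightarrow> unimodular_hom \<gamma>" using \<Lambda> charactersD(1) by (auto simp: L_def)
  qed (use L_bound \<alpha> pos in \<open>auto simp: L_def\<close>)
  moreover have "card Z * measure \<mu> M \<le> measure \<mu> N"
    by (rule separated_cosets_measure_le[OF \<mu> M N sub(1) Z])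
  moreover have "(card P + 1) * measure \<mu> N \<le> measure \<mu> H"
  proof -
    have "0 \<notin> P" using \<Omega>'(1) ND(1) by (auto simp: P_def)
    \<comment> \<open>Besides the cosets in \<open>\<Omega>'\<close>, the subgroup \<open>N\<close> itself, represented by 0, fits into \<open>H\<close>.\<close>
    have "card (insert 0 P) * measure \<mu> N \<le> measure \<mu> H"
    proof (rule separated_cosets_measure_le[OF \<mu> N H sub(2)])
      fix x y assume xy: "x \<in> insert 0 P" "y \<in> insert 0 P" "x - y \<in> N"
      have PN: "c \<notin> N" if "c \<in> P" for c using that \<Omega>'(1) by (auto simp: P_def)
      show "x = y" using xy P_sep PN ND(3)[OF xy(3)] by auto
    qed (use finP PH HD(1) in auto)
    then show ?thesis using \<open>0 \<notin> P\<close> finP by simp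
  qed
  ultimately have A: "\<alpha> \<le> measure \<mu> M * (2 * card P + 2)"
    and B: "card Z * measure \<mu> M \<le> measure \<mu> N"
    and C: "(card P + 1) * measure \<mu> N \<le> measure \<mu> H" by auto
  have "\<alpha> * card Z \<le> measure \<mu> M * (2 * card P + 2) * card Z"
    by (intro mult_right_mono A) auto
  also have "\<dots> = 2 * (card P + 1) * (card Z * measure \<mu> M)" by simp
  also have "\<dots> \<le> 2 * (card P + 1) * measure \<mu> N"
    by (intro mult_left_mono B) auto
  also have "\<dots> \<le> 2 * measure \<mu> H" using C by (simp add: algebra_simps)
  finally show ?thesis .
qed

section \<open>Subgroups of large index and the set without a Riesz basis\<close>

text \<open>
Balls around 0 for a translation-invariant ultrametric are subgroups.
\<close>

lemma nonarchimedean_small_open_subgroup: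
  fixes W :: "'a::topological_ab_group_add set"
  assumes na: "nonarchimedean_group_top (euclidean :: 'a topology)"
    and W: "open W" "0 \<in> W"
  obtains V where "additive_subgroup V" "open V" "V \<subseteq> W"
proof -
  obtain d where ms: "Metric_space (UNIV::'a set) d" and top: "Metric_space.mtopology UNIV d = euclidean"
    and ultra: "\<And>x y z. d x z \<le> max (d x y) (d y z)" and inv: "\<And>a x y. d (a + x) (a + y) = d x y"
    using na unfolding nonarchimedean_group_top_def by blast
  interpret Metric_space UNIV d by (rule ms)
  have "openin mtopology W" using W(1) by (simp add: top)
  then obtain r where r: "r > 0" "mball 0 r \<subseteq> W" using W(2) by (auto simp: openin_mtopology)
  have "additive_subgroup (mball 0 r)"
    unfolding additive_subgroup_def
  proof (intro conjI ballI)
    show "0 \<in> mball 0 r" using r by simp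
    fix x y assume xy: "x \<in> mball 0 r" "y \<in> mball 0 r"
    have "d 0 (x - y) = d y x" using inv[of y 0 "x - y"] by simp
    also have "\<dots> \<le> max (d y 0) (d 0 x)" by (rule ultra)
    also have "\<dots> < r" using xy commute[of y 0] by simp
    finally show "x - y \<in> mball 0 r" by simp
  qed
  moreover have "open (mball 0 r)" using openin_mball[of 0 r] by (simp add: top)
  ultimately show ?thesis using r(2) by (rule that)
qed

lemma nondiscrete_open_infinite:
  fixes U :: "'a::{topological_ab_group_add, t2_space} set"
  assumes nd: "(euclidean :: 'a topology) \<noteq> discrete_topology UNIV" and U: "open U" "0 \<in> U"
  shows "infinite U"
proof
  assume "finite U"
  then have "closed (U - {0})" by (intro finite_imp_closed) simp
  then have "open (U - (U - {0}))" using U by (intro open_Diff)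
  moreover have "U - (U - {0}) = {0}" using U by blast
  ultimately have "open {0::'a}" by simp
  then have "open {x}" for x :: 'a using open_coset[of "{0}" x] by simp
  then have "discrete_topology UNIV = (euclidean :: 'a topology)"
    by (simp add: discrete_topology_unique)
  with nd show False by simp
qed

lemma compact_open_subgroup_within:
  fixes W :: "'a::topological_ab_group_add set"
  assumes na: "nonarchimedean_group_top (euclidean :: 'a topology)"
    and W: "open W" "0 \<in> W" "W \<subseteq> K" "compact K"
  obtains V where "compact_open_subgroup V" "V \<subseteq> W"
proof -
  obtain V where V: "additive_subgroup V" "open V" "V \<subseteq> W"
    using nonarchimedean_small_open_subgroup[OF na W(1,2)] .
  have "compact (K \<inter> V)" using W(4) open_subgroup_closed[OF V(1,2)] by (rule compact_Int_closed)
  moreover have "K \<inter> V = V" using V(3) W(3) by blast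
  ultimately show ?thesis using that V by (simp add: compact_open_subgroup_def)
qed

text \<open>
The index is witnessed by \<open>n\<close> points of \<open>N\<close> in different cosets of \<open>M\<close>: since \<open>N\<close> is infinite, such
points can be chosen first, and \<open>M\<close> is then taken small enough to miss their finitely many differences.
\<close>

lemma compact_open_subgroup_of_large_index:
  fixes N :: "'a::{topological_ab_group_add, t2_space} set"
  assumes na: "nonarchimedean_group_top (euclidean :: 'a topology)"
    and nd: "(euclidean :: 'a topology) \<noteq> discrete_topology UNIV"
    and N: "compact_open_subgroup N"
  obtains M Z where "compact_open_subgroup M" "M \<subseteq> N" "finite Z" "Z \<subseteq> N" "card Z = n"
    "\<And>x y. x \<in> Z \<Longrightarrow> y \<in> Z \<Longrightarrow> x - y \<in> M \<Longrightarrow> x = y"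
proof -
  have Ns: "open N" "0 \<in> N" "compact N"
    using N additive_subgroupD(1) by (auto simp: compact_open_subgroup_def)
  obtain Z where Z: "finite Z" "card Z = n" "Z \<subseteq> N"
    using infinite_arbitrarily_large[OF nondiscrete_open_infinite[OF nd Ns(1,2)], of n] by blast
  define D where "D = (\<lambda>(x, y). x - y) ` (Z \<times> Z) - {0}"
  have "closed D" unfolding D_def using Z by (intro finite_imp_closed) auto
  then have "open (N - D)" using Ns by (intro open_Diff)
  moreover have "0 \<in> N - D" using Ns by (simp add: D_def)
  ultimately obtain M where M: "compact_open_subgroup M" "M \<subseteq> N - D"
    using compact_open_subgroup_within[OF na, of "N - D" N] Ns by blast
  have "x = y" if "x \<in> Z" "y \<in> Z" "x - y \<in> M" for x y
    using that M(2) by (auto simp: D_def)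
  with that[OF M(1) _ Z(1,3,2)] M(2) show ?thesis by blast
qed

lemma compact_open_subgroup_chain:
  fixes N0 :: "'a::{topological_ab_group_add, t2_space} set"
  assumes na: "nonarchimedean_group_top (euclidean :: 'a topology)"
    and nd: "(euclidean :: 'a topology) \<noteq> discrete_topology UNIV"
    and N0: "compact_open_subgroup N0"
  obtains N :: "nat \<Rightarrow> 'a set" and Z where
    "\<And>n. compact_open_subgroup (N n)" "\<And>n. N (Suc n) \<subseteq> N n"
    "\<And>n. finite (Z n)" "\<And>n. Z n \<subseteq> N n" "\<And>n. card (Z n) = n + 2"
    "\<And>n x y. x \<in> Z n \<Longrightarrow> y \<in> Z n \<Longrightarrow> x - y \<in> N (Suc n) \<Longrightarrow> x = y"
proof -
  let ?Q = "\<lambda>n N M Z. M \<subseteq> N \<and> finite Z \<and> Z \<subseteq> N \<and> card Z = n + 2 \<and>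
      (\<forall>x\<in>Z. \<forall>y\<in>Z. x - y \<in> M \<longrightarrow> x = (y::'a))"
  have "\<exists>N. \<forall>n. compact_open_subgroup (N n) \<and> (\<exists>Z. ?Q n (N n) (N (Suc n)) Z)"
  proof (rule dependent_nat_choice)
    show "\<exists>N. compact_open_subgroup (N::'a set)" using N0 by blast
    fix N :: "'a set" and n assume N: "compact_open_subgroup N"
    show "\<exists>M. compact_open_subgroup M \<and> (\<exists>Z. ?Q n N M Z)"
      by (rule compact_open_subgroup_of_large_index[OF na nd N, of "n + 2"]) blast
  qed
  then obtain N where N: "\<And>n. compact_open_subgroup (N n)" "\<And>n. \<exists>Z. ?Q n (N n) (N (Suc n)) Z"
    by blast
  then obtain Z where Z: "\<And>n. ?Q n (N n) (N (Suc n)) (Z n)" by metis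
  show ?thesis
    by (rule that[of N Z]) (use N(1) Z in blast)+
qed

theorem theorem1p5:
  fixes \<mu> :: "'a::{topological_ab_group_add, t2_space} measure"
  assumes "polish_top (euclidean :: 'a topology)"
    and "locally_compact_space (euclidean :: 'a topology)"
    and "nonarchimedean_group_top (euclidean :: 'a topology)"
    and "(euclidean :: 'a topology) \<noteq> discrete_topology UNIV"
    and "haar_measure \<mu>"
  shows "\<exists>\<Omega>::'a set. open \<Omega> \<and> (\<exists>K. compact K \<and> \<Omega> \<subseteq> K) \<and>
           0 < emeasure \<mu> \<Omega> \<and> emeasure \<mu> \<Omega> < \<infinity> \<and>
           (\<forall>\<Lambda>. \<Lambda> \<subseteq> characters \<longrightarrow> \<not> forms_riesz_basis \<mu> \<Omega> \<Lambda>)"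
proof -
  note \<mu> = assms(5)
  have sep: "separable_space (euclidean :: 'a topology)" using assms(1) by (simp add: polish_top_def)
  have "\<exists>U K. open U \<and> compact K \<and> (0::'a) \<in> U \<and> U \<subseteq> K"
    using assms(2) unfolding locally_compact_space_def by auto
  then obtain U K where UK: "open U" "(0::'a) \<in> U" "U \<subseteq> K" "compact K" by blast
  obtain N0 :: "'a set" where N0: "compact_open_subgroup N0"
    using compact_open_subgroup_within[OF assms(3) UK] by blast
  obtain N :: "nat \<Rightarrow> 'a set" and Z where N: "\<And>n. compact_open_subgroup (N n)" "\<And>n. N (Suc n) \<subseteq> N n"
    and Z: "\<And>n. finite (Z n)" "\<And>n. Z n \<subseteq> N n" "\<And>n. card (Z n) = n + 2"
    "\<And>n x y. x \<in> Z n \<Longrightarrow> y \<in> Z n \<Longrightarrow> x - y \<in> N (Suc n) \<Longrightarrow> x = y"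
    using compact_open_subgroup_chain[OF assms(3,4) N0] by blast
  have Ns: "additive_subgroup (N n)" "open (N n)" "compact (N n)" for n
    using N(1) by (auto simp: compact_open_subgroup_def)
  have anti: "N j \<subseteq> N i" if "i \<le> j" for i j
    using lift_Suc_antimono_le[of N, OF N(2) that] .
  have pos: "emeasure \<mu> (N n) > 0" for n
    by (rule open_subgroup_measure_pos[OF \<mu> sep Ns(1,2)])
  \<comment> \<open>The index is at least \<open>n + 2\<close>, hence at least 2 for every \<open>n\<close>.\<close>
  have "\<exists>x. x \<in> N n \<and> x \<notin> N (Suc n)" for n
  proof (rule ccontr)
    assume "\<nexists>x. x \<in> N n \<and> x \<notin> N (Suc n)"
    then have "N n \<subseteq> N (Suc n)" by blast
    then have "\<forall>x\<in>Z n. \<forall>y\<in>Z n. x = y"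
      using Z(2,4) additive_subgroupD(2)[OF Ns(1)] by (meson subsetD)
    then have "card (Z n) \<le> 1" using card_le_Suc0_iff_eq[OF Z(1)] by simp
    then show False using Z(3)[of n] by simp
  qed
  then obtain x where x: "\<And>n. x n \<in> N n" "\<And>n. x n \<notin> N (Suc n)" by metis
  define S where "S n = (+) (x n) ` N (Suc n)" for n
  define \<Omega> where "\<Omega> = (\<Union>n. S n)"
  have S_sub: "S n \<subseteq> N n" for n
    unfolding S_def by (rule coset_subset[OF Ns(1) x(1) N(2)])
  have \<Omega>_open: "open \<Omega>" unfolding \<Omega>_def S_def using open_coset[OF Ns(2)] by blast
  have \<Omega>_sub: "\<Omega> \<subseteq> N 0" unfolding \<Omega>_def
    by (intro UN_least order_trans[OF S_sub] anti) simp
  have "emeasure \<mu> (S 0) = emeasure \<mu> (N 1)"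
    unfolding S_def using haar_measureD(3)[OF \<mu> borel_open[OF Ns(2)]] by simp
  moreover have "emeasure \<mu> (S 0) \<le> emeasure \<mu> \<Omega>"
    using \<Omega>_open haar_measureD(1)[OF \<mu>] by (intro emeasure_mono) (auto simp: \<Omega>_def)
  ultimately have \<Omega>_pos: "0 < emeasure \<mu> \<Omega>" using pos[of 1] by simp
  have "emeasure \<mu> \<Omega> \<le> emeasure \<mu> (N 0)"
    using \<Omega>_sub compact_open_subgroup_measure(1)[OF \<mu> N(1)] by (intro emeasure_mono)
  then have \<Omega>_fin: "emeasure \<mu> \<Omega> < \<infinity>"
    using compact_open_subgroup_measure(2)[OF \<mu> N(1)] le_less_trans by blast
  have "\<not> forms_riesz_basis \<mu> \<Omega> \<Lambda>" if \<Lambda>: "\<Lambda> \<subseteq> characters" for \<Lambda>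
  proof
    assume "forms_riesz_basis \<mu> \<Omega> \<Lambda>"
    then have riesz: "L2_riesz_basis (restrict_space \<mu> \<Omega>) \<Lambda> (\<lambda>\<gamma>. restrict \<gamma> \<Omega>)"
      by (simp add: forms_riesz_basis_def)
    obtain \<alpha> where \<alpha>: "\<alpha> > 0" and frame: "\<And>h J. h \<in> L2 (restrict_space \<mu> \<Omega>) \<Longrightarrow> finite J \<Longrightarrow> J \<subseteq> \<Lambda> \<Longrightarrow>
       (\<And>\<gamma>. \<gamma> \<in> \<Lambda> - J \<Longrightarrow> L2_inner (restrict_space \<mu> \<Omega>) h (restrict \<gamma> \<Omega>) = 0) \<Longrightarrow>
       \<alpha> * (L2_norm (restrict_space \<mu> \<Omega>) h)\<^sup>2
         \<le> (\<Sum>\<gamma>\<in>J. (cmod (L2_inner (restrict_space \<mu> \<Omega>) h (restrict \<gamma> \<Omega>)))\<^sup>2)"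
      using riesz_basis_lower_bound[OF riesz] by metis
    \<comment> \<open>The case \<open>n = 0\<close> is excluded because the coarse part of \<open>\<Omega>\<close> would be empty.\<close>
    have bound: "\<alpha> * card (Z n) \<le> 2 * measure \<mu> (N 0)" if n: "n > 0" for n
    proof (rule riesz_lower_bound_index_le[where \<Omega>' = "\<Union>j<n. S j" and N = "N n" and M = "N (Suc n)"
          and b = "x n" and \<Omega> = \<Omega> and \<Lambda> = \<Lambda>, OF \<mu> N(1) N(1) N(1)])
      show "measure \<mu> (N (Suc n)) > 0"
        using pos[of "Suc n"] compact_open_subgroup_measure(2)[OF \<mu> N(1), of "Suc n"]
        by (simp add: measure_def enn2real_positive_iff)
      show "N (Suc n) \<subseteq> N n" "N n \<subseteq> N 0" using anti by auto
      show "(\<Union>j<n. S j) \<union> (+) (x n) ` N (Suc n) \<subseteq> \<Omega>" by (auto simp: \<Omega>_def S_def)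
      show "\<Omega> \<subseteq> (\<Union>j<n. S j) \<union> (+) (x n) ` N (Suc n) \<union> N (Suc n)"
      proof
        fix y assume "y \<in> \<Omega>"
        then obtain j where j: "y \<in> S j" by (auto simp: \<Omega>_def)
        consider "j < n" | "j = n" | "Suc n \<le> j" by linarith
        then show "y \<in> (\<Union>j<n. S j) \<union> (+) (x n) ` N (Suc n) \<union> N (Suc n)"
        proof cases
          case 3
          then show ?thesis using j S_sub anti by blast
        qed (use j S_def in auto)
      qed
      show "(\<Union>j<n. S j) \<subseteq> N 0 - N n"
      proof
        fix y assume "y \<in> (\<Union>j<n. S j)"
        then obtain j where j: "j < n" "y \<in> S j" by blast
        have yx: "y - x j \<in> N (Suc j)" using j(2) unfolding S_def mem_coset_iff .
        have "y \<notin> N n"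
        proof
          assume "y \<in> N n"
          then have "y \<in> N (Suc j)" using anti[of "Suc j" n] j(1) by auto
          then have "y - (y - x j) \<in> N (Suc j)" using additive_subgroupD(2)[OF Ns(1)] yx by blast
          with x(2) show False by simp
        qed
        then show "y \<in> N 0 - N n" using j(2) S_sub anti[of 0 j] by blast
      qed
      have "x 0 \<in> S 0" unfolding S_def by (rule self_in_coset[OF Ns(1)])
      then show "(\<Union>j<n. S j) \<noteq> {}" using n by blast
      show "y + z \<in> (\<Union>j<n. S j)" if y: "y \<in> (\<Union>j<n. S j)" and z: "z \<in> N n" for y z
      proof -
        obtain j where j: "j < n" "y - x j \<in> N (Suc j)"
          using y unfolding S_def by (auto simp: mem_coset_iff)
        have "z \<in> N (Suc j)" using z anti[of "Suc j" n] j(1) by auto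
        then have "y - x j + z \<in> N (Suc j)" by (rule additive_subgroupD(4)[OF Ns(1) j(2)])
        then have "y + z \<in> S j" unfolding S_def mem_coset_iff by (simp add: algebra_simps)
        then show ?thesis using j(1) by blast
      qed
    qed (fact \<Omega>_open x \<Lambda> riesz \<alpha> frame Z)+
    obtain n where n: "2 * measure \<mu> (N 0) < real n * \<alpha>"
      using reals_Archimedean3[OF \<alpha>] by blast
    have "real n * \<alpha> \<le> \<alpha> * card (Z (Suc n))" using Z(3) \<alpha> by (simp add: algebra_simps)
    also have "\<dots> \<le> 2 * measure \<mu> (N 0)" by (rule bound) simp
    finally show False using n by simp
  qed
  then show ?thesis using \<Omega>_open \<Omega>_sub Ns(3) \<Omega>_pos \<Omega>_fin by blast
qed

end
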